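(* Let $\epsilon>0$ and let $\{(x^k,\lambda^k)\}_{k\ge0}$ be generated by Algorithm ALSSF. Suppose that (B1) and (B2) hold on a compact set $\mathcal{S}$ to which the primal iterates belong, that there exists $M>0$ such that $\|\lambda^k\|\le M$ for any $k\ge0$, and that $\rho\ge\frac{2M}{\epsilon}$, $\beta\ge L_\rho$ and $H_\rho\le\upsilon\le2H_\rho$. Then (with $\rho$ of order $1/\epsilon$ and $\beta$ of order $L_\rho$) Algorithm ALSSF yields an $\epsilon$-second-order solution of the problem $\min_x f(x)$ s.t. $F(x)=0$ after at most $K$ iterations, where $$K=\mathcal{O}\left(\frac{1}{\epsilon^{1-\zeta_2}}\log\left(\frac1\epsilon\right)+\frac1\epsilon+\frac{1}{\epsilon^{2-3\zeta_1}}\right).$$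
   Context: Problem: $\min_{x\in\mathbb{R}^n} f(x)$ subject to $F(x)=0$, $F=(F_1,\dots,F_m)^T$, with $f,F_i:\mathbb{R}^n\to\mathbb{R}$ twice continuously differentiable; feasible set nonempty, optimal value finite. $\|\cdot\|$ is the Euclidean norm of a vector or spectral norm of a matrix, $J_F$ the Jacobian of $F$, $\lambda_{\min}$ the smallest eigenvalue, $I_n$ the identity. $\epsilon$-second-order solution: a point $x^*_\epsilon$ for which there exists $\lambda^*_\epsilon\in\mathbb{R}^m$ with $\|\nabla f(x^*_\epsilon)+J_F(x^*_\epsilon)^T\lambda^*_\epsilon\|\le\epsilon$, $\|F(x^*_\epsilon)\|\le\epsilon$, and $d^T\big(\nabla^2f(x^*_\epsilon)+\sum_{i=1}^m(\lambda^*_\epsilon)_i\nabla^2F_i(x^*_\epsilon)\big)d\ge-\epsilon$ for all $d\in\mathbb{R}^n$ with $J_F(x^*_\epsilon)d=0$, $\|d\|=1$. Functions: $\mathcal{L}_\rho(x,\lambda)=f(x)+\langle\lambda,F(x)\rangle+\frac\rho2\|F(x)\|^2$; $\bar{\mathcal{L}}_\rho(x,\lambda;\bar x)=f(\bar x)+\langle\nabla f(\bar x),x-\bar x\rangle+\langle\lambda,F(\bar x)+J_F(\bar x)(x-\bar x)\rangle+\frac\rho2\|F(\bar x)+J_F(\bar x)(x-\bar x)\|^2$; $\hat{\mathcal{Q}}_{\mathcal{L}_\rho}(x,\lambda;\bar x)=\mathcal{L}_\rho(\bar x,\lambda)+\langle\nabla_x\mathcal{L}_\rho(\bar x,\lambda),x-\bar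 x\rangle+\frac12(x-\bar x)^T\nabla^2_{xx}\mathcal{L}_\rho(\bar x,\lambda)(x-\bar x)$. (B1) For any compact $\mathcal{S}\subseteq\mathbb{R}^n$ there exist positive constants $M_f,M_F,L_f,L_F,H_f,M_{F_i},L_{F_i},H_{F_i}$ ($i=1,\dots,m$) such that for all $x,y\in\mathcal{S}$: $\|\nabla f(x)\|\le M_f$, $\|\nabla^2f(x)\|\le L_f$, $\|\nabla^2f(x)-\nabla^2f(y)\|\le H_f\|x-y\|$; $\|J_F(x)\|\le M_F$, $\|J_F(x)-J_F(y)\|\le L_F\|x-y\|$; $\|\nabla F_i(x)\|\le M_{F_i}$, $\|\nabla^2F_i(x)\|\le L_{F_i}$, $\|\nabla^2F_i(x)-\nabla^2F_i(y)\|\le H_{F_i}\|x-y\|$. Constants, for a compact $\Lambda\subseteq\mathbb{R}^m$ containing the dual iterates: $L_\rho=\sup_{(x,\lambda)\in\mathcal{S}\times\Lambda}\{L_f+L_F\|\lambda+\rho F(x)\|+\rho M_F^2\}$ and $H_\rho=\sup_{(x,\lambda)\in\mathcal{S}\times\Lambda}\{H_f+\|\lambda+\rho F(x)\|_\infty\sum_{i=1}^mH_{F_i}+\rho(2M_FL_F+\sum_{i=1}^mM_{F_i}L_{F_i})\}$; these are Lipschitz constants of $\nabla_x\mathcal{L}_\rho(\cdot,\lambda)$ and $\nabla^2_{xx}\mathcal{L}_\rho(\cdot,\lambda)$. Strict saddle: for positive $\alpha,\theta,\gamma,\xi$, a twice differentiable $\varphi:\mathbb{R}^n\to\mathbb{R}$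 is $(\alpha,\theta,\gamma,\xi)$-strict saddle on $\mathcal{X}\subseteq\mathbb{R}^n$ if $\mathcal{X}$ is decomposed as $\mathcal{R}_1\cup\mathcal{R}_2\cup\mathcal{R}_3$, where $\mathcal{R}_1=\{x:\|\nabla\varphi(x)\|\ge\alpha\}$, $\mathcal{R}_2=\{x:\lambda_{\min}(\nabla^2\varphi(x))\le-\theta\}$, $\mathcal{R}_3=\{x:\exists$ a local minimizer $x^*$ of $\varphi$ with $\mathrm{dist}(x,x^* )\le\xi$ and $\varphi$ $\gamma$-strongly convex over $\{y:\mathrm{dist}(y,x^* )\le\xi\}\}$ (i.e. every point of $\mathcal{X}$ is in one of these sets). (B2) For the fixed $\epsilon>0$, $\mathcal{L}_\rho(\cdot,\lambda)$ is $(\alpha,\theta\rho^{\zeta_1},\gamma\rho^{\zeta_2},\xi)$-strict saddle on $\{x:\|F(x)\|\le\epsilon\}$, where $\zeta_1,\zeta_2\in[0,1]$ and $\lambda\in\Lambda$ is given. Algorithm ALSSF. Inputs $x^0\in\mathbb{R}^n$, $\lambda^0\in\mathbb{R}^m$, $\epsilon,\rho,\beta,\upsilon>0$. For $k=0,1,\dots$: (a) if $\|\nabla_x\mathcal{L}_\rho(x^k,\lambda^k)\|>\alpha$, set $x^{k+1}=\arg\min_x\bar{\mathcal{L}}_\rho(x,\lambda^k;x^k)+\frac\beta2\|x-x^k\|^2$; (b) else if $\lambda_{\min}(\nabla^2_{xx}\mathcal{L}_\rho(x^k,\lambda^k))<-\theta\rho^{\zeta_1}$, set $x^{k+1}=\arg\min_x\hat{\mathcal{Q}}_{\mathcal{L}_\rho}(x,\lambda^k;x^k)+\frac\upsilon6\|x-x^k\|^3$;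 (c) else set $x^{k+1}=\arg\min_x\langle\nabla f(x^k)+J_F(x^k)^T(\lambda^k+\rho F(x^k)),x-x^k\rangle+\frac\beta2\|x-x^k\|^2$. Then, if $\|F(x^{k+1})\|>\epsilon$, set $\lambda^{k+1}=\lambda^k+\rho F(x^{k+1})$; otherwise $\lambda^{k+1}=\lambda^k$. The $\mathcal{O}$ hides constants independent of $\epsilon$; $L_\rho$ and $H_\rho$ are of order $\rho$.
   Formalization: The compact set S is also assumed convex, and no iterate x^k with k≥1 may have gradient norm of L_ρ below α and λ_min of its Hessian exactly equal to -θρ^{ζ1}; without either assumption the claim fails, since the iteration can cycle or stall at a saddle point. *)

theory Defs
  imports "HOL-Analysis.Analysis" "HOL-Library.Landau_Symbols"
begin

definition grad :: "(real ^ 'n \<Rightarrow> real) \<Rightarrow> real ^ 'n \<Rightarrow> real ^ 'n"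
  where "grad \<phi> x = (THE D. GDERIV \<phi> x :> D)"

definition hess :: "(real ^ 'n \<Rightarrow> real) \<Rightarrow> real ^ 'n \<Rightarrow> real ^ 'n ^ 'n"
  where "hess \<phi> x = jacobian (grad \<phi>) (at x)"

definition twice_diff :: "(real ^ 'n \<Rightarrow> real) \<Rightarrow> bool"
  where "twice_diff \<phi> \<longleftrightarrow>
    (\<forall>x. \<phi> differentiable (at x)) \<and> (\<forall>x. grad \<phi> differentiable (at x))"

definition twice_cont_diff :: "(real ^ 'n \<Rightarrow> real) \<Rightarrow> bool"
  where "twice_cont_diff \<phi> \<longleftrightarrow> twice_diff \<phi> \<and> continuous_on UNIV (hess \<phi>)"

(* The library norm on real ^ 'n ^ 'm is the Frobenius norm, so the spectral norm is
   defined separately. *)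
definition spec_norm :: "real ^ 'n ^ 'm \<Rightarrow> real"
  where "spec_norm A = onorm ((*v) A)"

(* Used only for symmetric A, whose set of eigenvalues is finite and nonempty. *)
definition lambda_min :: "real ^ 'n ^ 'n \<Rightarrow> real"
  where "lambda_min A = Min {c. \<exists>v. v \<noteq> 0 \<and> A *v v = c *\<^sub>R v}"

definition eps_second_order ::
  "real \<Rightarrow> (real ^ 'n \<Rightarrow> real) \<Rightarrow> (real ^ 'n \<Rightarrow> real ^ 'm) \<Rightarrow> real ^ 'n \<Rightarrow> bool"
  where "eps_second_order \<epsilon> f F x \<longleftrightarrow>
    (\<exists>l. norm (grad f x + transpose (jacobian F (at x)) *v l) \<le> \<epsilon> \<and>
         norm (F x) \<le> \<epsilon> \<and>
         (\<forall>d. jacobian F (at x) *v d = 0 \<and> norm d = 1 \<longrightarrow>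
            d \<bullet> ((hess f x + (\<Sum>i\<in>UNIV. l $ i *\<^sub>R hess (\<lambda>y. F y $ i) x)) *v d) \<ge> - \<epsilon>))"

definition aug_lag ::
  "(real ^ 'n \<Rightarrow> real) \<Rightarrow> (real ^ 'n \<Rightarrow> real ^ 'm) \<Rightarrow> real \<Rightarrow> real ^ 'm \<Rightarrow> real ^ 'n \<Rightarrow> real"
  where "aug_lag f F \<rho> l x = f x + l \<bullet> F x + \<rho> / 2 * (norm (F x))\<^sup>2"

definition lin_aug_lag ::
  "(real ^ 'n \<Rightarrow> real) \<Rightarrow> (real ^ 'n \<Rightarrow> real ^ 'm) \<Rightarrow> real \<Rightarrow> real ^ 'm \<Rightarrow> real ^ 'n \<Rightarrow> real ^ 'n \<Rightarrow> real"
  where "lin_aug_lag f F \<rho> l xb x =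
    f xb + grad f xb \<bullet> (x - xb)
    + l \<bullet> (F xb + jacobian F (at xb) *v (x - xb))
    + \<rho> / 2 * (norm (F xb + jacobian F (at xb) *v (x - xb)))\<^sup>2"

definition quad_aug_lag ::
  "(real ^ 'n \<Rightarrow> real) \<Rightarrow> (real ^ 'n \<Rightarrow> real ^ 'm) \<Rightarrow> real \<Rightarrow> real ^ 'm \<Rightarrow> real ^ 'n \<Rightarrow> real ^ 'n \<Rightarrow> real"
  where "quad_aug_lag f F \<rho> l xb x =
    aug_lag f F \<rho> l xb + grad (aug_lag f F \<rho> l) xb \<bullet> (x - xb)
    + 1 / 2 * ((x - xb) \<bullet> (hess (aug_lag f F \<rho> l) xb *v (x - xb)))"

definition smoothness_consts ::
  "(real ^ 'n \<Rightarrow> real) \<Rightarrow> (real ^ 'n \<Rightarrow> real ^ 'm) \<Rightarrow> (real ^ 'n) set \<Rightarrow>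
    real \<Rightarrow> real \<Rightarrow> real \<Rightarrow> real \<Rightarrow> real \<Rightarrow> ('m \<Rightarrow> real) \<Rightarrow> ('m \<Rightarrow> real) \<Rightarrow> ('m \<Rightarrow> real) \<Rightarrow> bool"
  where "smoothness_consts f F S Mf MF Lf LF Hf MFi LFi HFi \<longleftrightarrow>
    Mf > 0 \<and> MF > 0 \<and> Lf > 0 \<and> LF > 0 \<and> Hf > 0 \<and>
    (\<forall>i. MFi i > 0 \<and> LFi i > 0 \<and> HFi i > 0) \<and>
    (\<forall>x\<in>S. \<forall>y\<in>S.
       norm (grad f x) \<le> Mf \<and>
       spec_norm (hess f x) \<le> Lf \<and>
       spec_norm (hess f x - hess f y) \<le> Hf * norm (x - y) \<and>
       spec_norm (jacobian F (at x)) \<le> MF \<and>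
       spec_norm (jacobian F (at x) - jacobian F (at y)) \<le> LF * norm (x - y) \<and>
       (\<forall>i. norm (grad (\<lambda>z. F z $ i) x) \<le> MFi i \<and>
            spec_norm (hess (\<lambda>z. F z $ i) x) \<le> LFi i \<and>
            spec_norm (hess (\<lambda>z. F z $ i) x - hess (\<lambda>z. F z $ i) y)
              \<le> HFi i * norm (x - y)))"

(* For convex S, L_aug and H_aug are Lipschitz constants on S of the gradient and of the Hessian
   of aug_lag f F \<rho> l for every l in \<Lambda>; this may fail for non-convex S. *)
definition L_aug ::
  "(real ^ 'n \<Rightarrow> real ^ 'm) \<Rightarrow> (real ^ 'n) set \<Rightarrow> (real ^ 'm) set \<Rightarrow>
    real \<Rightarrow> real \<Rightarrow> real \<Rightarrow> real \<Rightarrow> real"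
  where "L_aug F S \<Lambda> MF Lf LF \<rho> =
    (SUP (x, l) \<in> S \<times> \<Lambda>. Lf + LF * norm (l + \<rho> *\<^sub>R F x) + \<rho> * MF\<^sup>2)"

definition H_aug ::
  "(real ^ 'n \<Rightarrow> real ^ 'm) \<Rightarrow> (real ^ 'n) set \<Rightarrow> (real ^ 'm) set \<Rightarrow>
    real \<Rightarrow> real \<Rightarrow> real \<Rightarrow> ('m \<Rightarrow> real) \<Rightarrow> ('m \<Rightarrow> real) \<Rightarrow> ('m \<Rightarrow> real) \<Rightarrow> real \<Rightarrow> real"
  where "H_aug F S \<Lambda> MF LF Hf MFi LFi HFi \<rho> =
    (SUP (x, l) \<in> S \<times> \<Lambda>.
       Hf + infnorm (l + \<rho> *\<^sub>R F x) * (\<Sum>i\<in>UNIV. HFi i)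
       + \<rho> * (2 * MF * LF + (\<Sum>i\<in>UNIV. MFi i * LFi i)))"

definition local_minimizer :: "(real ^ 'n \<Rightarrow> real) \<Rightarrow> real ^ 'n \<Rightarrow> bool"
  where "local_minimizer \<phi> x \<longleftrightarrow> (\<forall>\<^sub>F y in nhds x. \<phi> x \<le> \<phi> y)"

definition strongly_convex_on :: "real \<Rightarrow> (real ^ 'n) set \<Rightarrow> (real ^ 'n \<Rightarrow> real) \<Rightarrow> bool"
  where "strongly_convex_on \<gamma> C \<phi> \<longleftrightarrow> convex C \<and>
    (\<forall>x\<in>C. \<forall>y\<in>C. \<forall>t\<in>{0..1}.
       \<phi> ((1 - t) *\<^sub>R x + t *\<^sub>R y)
         \<le> (1 - t) * \<phi> x + t * \<phi> y - \<gamma> / 2 * t * (1 - t) * (norm (x - y))\<^sup>2)"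

definition strict_saddle ::
  "real \<Rightarrow> real \<Rightarrow> real \<Rightarrow> real \<Rightarrow> (real ^ 'n \<Rightarrow> real) \<Rightarrow> (real ^ 'n) set \<Rightarrow> bool"
  where "strict_saddle \<alpha> \<theta> \<gamma> \<xi> \<phi> X \<longleftrightarrow>
    twice_diff \<phi> \<and>
    X \<subseteq> {x. norm (grad \<phi> x) \<ge> \<alpha>}
      \<union> {x. lambda_min (hess \<phi> x) \<le> - \<theta>}
      \<union> {x. \<exists>z. local_minimizer \<phi> z \<and> dist x z \<le> \<xi> \<and> strongly_convex_on \<gamma> (cball z \<xi>) \<phi>}"

definition alssf_primal_step ::
  "(real ^ 'n \<Rightarrow> real) \<Rightarrow> (real ^ 'n \<Rightarrow> real ^ 'm) \<Rightarrow> real \<Rightarrow> real \<Rightarrow> real \<Rightarrow>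
    real \<Rightarrow> real \<Rightarrow> real \<Rightarrow> real ^ 'm \<Rightarrow> real ^ 'n \<Rightarrow> real ^ 'n \<Rightarrow> bool"
  where "alssf_primal_step f F \<alpha> \<theta> \<zeta>1 \<rho> \<beta> \<upsilon> l x x' \<longleftrightarrow>
    (if norm (grad (aug_lag f F \<rho> l) x) > \<alpha> then
       is_arg_min (\<lambda>y. lin_aug_lag f F \<rho> l x y + \<beta> / 2 * (norm (y - x))\<^sup>2) (\<lambda>_. True) x'
     else if lambda_min (hess (aug_lag f F \<rho> l) x) < - (\<theta> * \<rho> powr \<zeta>1) then
       is_arg_min (\<lambda>y. quad_aug_lag f F \<rho> l x y + \<upsilon> / 6 * (norm (y - x)) ^ 3) (\<lambda>_. True) x'
     else
       is_arg_min
         (\<lambda>y. (grad f x + transpose (jacobian F (at x)) *v (l + \<rho> *\<^sub>R F x)) \<bullet> (y - x)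
              + \<beta> / 2 * (norm (y - x))\<^sup>2) (\<lambda>_. True) x')"

definition alssf_run ::
  "(real ^ 'n \<Rightarrow> real) \<Rightarrow> (real ^ 'n \<Rightarrow> real ^ 'm) \<Rightarrow> real \<Rightarrow> real \<Rightarrow> real \<Rightarrow>
    real \<Rightarrow> real \<Rightarrow> real \<Rightarrow> real \<Rightarrow> (nat \<Rightarrow> real ^ 'n) \<Rightarrow> (nat \<Rightarrow> real ^ 'm) \<Rightarrow> bool"
  where "alssf_run f F \<alpha> \<theta> \<zeta>1 \<epsilon> \<rho> \<beta> \<upsilon> x l \<longleftrightarrow>
    (\<forall>k. alssf_primal_step f F \<alpha> \<theta> \<zeta>1 \<rho> \<beta> \<upsilon> (l k) (x k) (x (Suc k)) \<and>
         l (Suc k) = (if norm (F (x (Suc k))) > \<epsilon> then l k + \<rho> *\<^sub>R F (x (Suc k)) else l k))"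

(* A point on the threshold of the curvature test is admitted by strict_saddle through the
   non-strict inequality, yet gets a gradient step because the test in alssf_primal_step is
   strict; a saddle point of this kind is a fixed point of the iteration. *)
definition on_curvature_threshold :: "real \<Rightarrow> real \<Rightarrow> (real ^ 'n \<Rightarrow> real) \<Rightarrow> real ^ 'n \<Rightarrow> bool"
  where "on_curvature_threshold \<alpha> \<theta> \<phi> x \<longleftrightarrow>
    norm (grad \<phi> x) < \<alpha> \<and> lambda_min (hess \<phi> x) = - \<theta>"

end

theory Submission
  imports Defs
begin

text \<open>The bound \<open>\<parallel>\<lambda>\<^sup>k\<parallel> \<le> M\<close> together with \<open>\<rho> \<ge> 2M / \<epsilon>\<close> rules out dual updates: an update at
an iterate with \<open>\<parallel>F\<parallel> > \<epsilon>\<close> would move the multiplier by more than \<open>2M\<close>.  So the multiplier is constant,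
every iterate after the first is \<open>\<epsilon>\<close>-feasible, and the algorithm is a descent method for the single
function \<open>\<phi> = \<L>\<^sub>\<rho>(\<cdot>, \<lambda>\<^sup>0)\<close> (\<open>multiplier_constant\<close>).  On \<open>\<epsilon>\<close>-feasible points of the compact set the
values of \<open>\<phi>\<close> lie in an interval whose length does not depend on \<open>\<rho>\<close>, because the penalty is at most
\<open>\<rho> \<epsilon>\<^sup>2 / 2\<close> and \<open>\<rho> = O(1 / \<epsilon>)\<close> (\<open>aug_lag_range\<close>).

Call an iterate a basin point if its gradient is below \<open>\<alpha> / 2\<close> and it lies in one of the balls of
strong convexity around a local minimizer.  At every other iterate \<open>\<phi>\<close> drops by a fixed amount
(\<open>progress\<close>): by \<open>\<alpha>\<^sup>2 / (8\<beta>)\<close> at a Gauss-Newton step, and also at a gradient step from a point with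
gradient at least \<open>\<alpha> / 2\<close>; by \<open>2\<tau>\<^sup>3 / (3\<upsilon>\<^sup>2)\<close>, with \<open>\<tau> = \<theta> \<rho>\<^sup>\<zeta>\<^sup>1\<close>, at a cubic step.  Since
\<open>\<beta>, \<upsilon> = O(1 / \<epsilon>)\<close>, a basin point is reached within \<open>O(1 / \<epsilon> + 1 / \<epsilon>\<^bsup>2 - 3\<zeta>1\<^esup>)\<close> iterations.

From a basin point on, only gradient steps with step length \<open>1 / \<beta>\<close> are made: such a step stays in
the ball (\<open>gradient_step_stays_in_ball\<close>) and multiplies the gradient norm by at most
\<open>exp (-\<gamma> \<rho>\<^sup>\<zeta>\<^sup>2 / \<beta>)\<close> (\<open>gradient_step_contraction\<close>), so the gradient never becomes large again and the
Hessian stays positive semidefinite.  Asking for \<open>\<alpha> / 2\<close> instead of \<open>\<alpha>\<close> matters here: one gradient step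
at most doubles the gradient, which shows that the step after it is a gradient step as well, before
the contraction is available.  Hence \<open>(\<beta> / (\<gamma> \<rho>\<^sup>\<zeta>\<^sup>2)) log (\<alpha> / (2\<epsilon>)) + O(1)\<close> further iterations give a
gradient of norm at most \<open>\<epsilon>\<close>.  There the multiplier \<open>\<lambda> + \<rho> F(x)\<close> certifies the \<open>\<epsilon>\<close>-second-order
conditions, because on the kernel of the Jacobian the Hessian of the Lagrangian for this multiplier
agrees with the Hessian of \<open>\<phi>\<close> (\<open>eps_second_orderI\<close>).\<close>

section \<open>Calculus of twice continuously differentiable functions\<close>

text \<open>Polarization: for unit vectors \<open>s\<close> and \<open>u\<close> the form at \<open>s \<plusminus> u\<close> lies between \<open>0\<close> and \<open>4 c\<close>, and
\<open>4 (A s \<bullet> u)\<close> is the difference of these two values.  Only the form on the span of the two vectors enters,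
which is what permits an application where \<open>A\<close> is controlled on a subspace alone.\<close>
lemma symmetric_form_bound:
  fixes A :: "'a::real_inner \<Rightarrow> 'a"
  assumes "linear A" and sym: "\<And>v w. A v \<bullet> w = A w \<bullet> v"
    and nonneg: "\<And>a b. 0 \<le> A (a *\<^sub>R s + b *\<^sub>R u) \<bullet> (a *\<^sub>R s + b *\<^sub>R u)"
    and upper: "\<And>a b. A (a *\<^sub>R s + b *\<^sub>R u) \<bullet> (a *\<^sub>R s + b *\<^sub>R u) \<le> c * (norm (a *\<^sub>R s + b *\<^sub>R u))\<^sup>2"
  shows "\<bar>A s \<bullet> u\<bar> \<le> c * norm s * norm u"
proof (cases "s = 0 \<or> u = 0")
  case True
  then show ?thesis using linear_0[OF assms(1)] by auto
next
  case False
  define v where "v = (1 / norm s) *\<^sub>R s"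
  define w where "w = (1 / norm u) *\<^sub>R u"
  have vw: "norm v = 1" "norm w = 1" using False by (auto simp: v_def w_def)
  have A: "A (x + y) = A x + A y" "A (x - y) = A x - A y" "A (r *\<^sub>R x) = r *\<^sub>R A x" for x y r
    using assms(1) by (simp_all add: linear_add linear_diff linear_cmul)
  have np: "0 \<le> A (v + w) \<bullet> (v + w)" "A (v + w) \<bullet> (v + w) \<le> c * (norm (v + w))\<^sup>2"
    using nonneg[of "1 / norm s" "1 / norm u"] upper[of "1 / norm s" "1 / norm u"]
    unfolding v_def w_def by auto
  have nm: "0 \<le> A (v - w) \<bullet> (v - w)" "A (v - w) \<bullet> (v - w) \<le> c * (norm (v - w))\<^sup>2"
    using nonneg[of "1 / norm s" "- (1 / norm u)"] upper[of "1 / norm s" "- (1 / norm u)"]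
    unfolding v_def w_def by auto
  have "A v \<bullet> v \<le> c" "0 \<le> A v \<bullet> v"
    using nonneg[of "1 / norm s" 0] upper[of "1 / norm s" 0] vw unfolding v_def by auto
  then have c: "0 \<le> c" by simp
  have n4: "(norm (v + w))\<^sup>2 \<le> 4" "(norm (v - w))\<^sup>2 \<le> 4"
    using power_mono[OF norm_triangle_ineq[of v w], of 2]
      power_mono[OF norm_triangle_ineq4[of v w], of 2] vw by auto
  have pol: "A (v + w) \<bullet> (v + w) - A (v - w) \<bullet> (v - w) = 4 * (A v \<bullet> w)"
    using sym[of w v] by (simp add: A inner_add_left inner_add_right inner_diff_left inner_diff_right)
  have "A (v + w) \<bullet> (v + w) \<le> 4 * c" "A (v - w) \<bullet> (v - w) \<le> 4 * c"
    using np(2) nm(2) mult_left_mono[OF n4(1) c] mult_left_mono[OF n4(2) c] by auto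
  then have "\<bar>A v \<bullet> w\<bar> \<le> c" using pol np(1) nm(1) by linarith
  moreover have "A v \<bullet> w = A s \<bullet> u / (norm s * norm u)"
    by (simp add: v_def w_def A)
  ultimately show ?thesis
    using False by (simp add: abs_mult divide_le_eq mult.assoc)
qed

text \<open>The Hessian is given as a function of the direction, so that the arguments below deal with linear maps and
quadratic forms and not with matrices.\<close>
locale C2_function =
  fixes \<phi> :: "real ^ 'n \<Rightarrow> real" and g :: "real ^ 'n \<Rightarrow> real ^ 'n"
    and H :: "real ^ 'n \<Rightarrow> real ^ 'n \<Rightarrow> real ^ 'n"
  assumes has_gradient: "(\<phi> has_derivative (\<lambda>h. g x \<bullet> h)) (at x)"
    and has_hessian: "(g has_derivative H x) (at x)"
    and hessian_continuous: "continuous_on UNIV (\<lambda>x. H x d)"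
begin

lemma linear_hessian: "linear (H x)"
  using has_hessian has_derivative_linear by blast

lemma DERIV_along_line:
  "((\<lambda>t. \<phi> (x + t *\<^sub>R s)) has_real_derivative g (x + t *\<^sub>R s) \<bullet> s) (at t)"
proof -
  have "((\<lambda>t. x + t *\<^sub>R s) has_derivative (\<lambda>h. h *\<^sub>R s)) (at t)"
    by (auto intro!: derivative_eq_intros)
  from has_derivative_compose[OF this has_gradient]
  have "((\<lambda>t. \<phi> (x + t *\<^sub>R s)) has_derivative (\<lambda>h. g (x + t *\<^sub>R s) \<bullet> (h *\<^sub>R s))) (at t)" .
  then show ?thesis
    unfolding has_field_derivative_def by (simp add: mult.commute[of "_ \<bullet> _"] mult_commute_abs)
qed

lemma DERIV_gradient_along_line:
  "((\<lambda>t. g (x + t *\<^sub>R s) \<bullet> u) has_real_derivative H (x + t *\<^sub>R s) s \<bullet> u) (at t)"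
proof -
  have "((\<lambda>t. x + t *\<^sub>R s) has_derivative (\<lambda>h. h *\<^sub>R s)) (at t)"
    by (auto intro!: derivative_eq_intros)
  from has_derivative_compose[OF this has_hessian]
  have "((\<lambda>t. g (x + t *\<^sub>R s)) has_derivative (\<lambda>h. H (x + t *\<^sub>R s) (h *\<^sub>R s))) (at t)" .
  from has_derivative_inner_left[OF this, of u]
  show ?thesis
    unfolding has_field_derivative_def
    by (simp add: linear_cmul[OF linear_hessian] mult_commute_abs)
qed

text \<open>The second difference of \<open>\<phi>\<close> over the parallelogram spanned by \<open>t u\<close> and \<open>t v\<close> is symmetric in
\<open>u\<close> and \<open>v\<close>; by the mean value theorem, applied twice, it is \<open>t\<^sup>2\<close> times an entry of the Hessian
at a nearby point.\<close>
lemma hessian_symmetric: "H x u \<bullet> v = H x v \<bullet> u"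
proof -
  have cross: "\<exists>a\<in>{0<..<t}. \<exists>b\<in>{0<..<t}.
      \<phi> (x + t *\<^sub>R u + t *\<^sub>R v) - \<phi> (x + t *\<^sub>R u) - \<phi> (x + t *\<^sub>R v) + \<phi> x
        = t\<^sup>2 * (H (x + a *\<^sub>R u + b *\<^sub>R v) v \<bullet> u)" if "t > 0" for t u v
  proof -
    define k where "k = (\<lambda>a. \<phi> (x + t *\<^sub>R v + a *\<^sub>R u) - \<phi> (x + a *\<^sub>R u))"
    have "DERIV k a :> g (x + t *\<^sub>R v + a *\<^sub>R u) \<bullet> u - g (x + a *\<^sub>R u) \<bullet> u" for a
      unfolding k_def by (intro DERIV_diff DERIV_along_line)
    from MVT2[OF that this] obtain a where a: "0 < a" "a < t"
      and ka: "k t - k 0 = t * (g (x + t *\<^sub>R v + a *\<^sub>R u) \<bullet> u - g (x + a *\<^sub>R u) \<bullet> u)" by auto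
    from MVT2[OF that DERIV_gradient_along_line[of "x + a *\<^sub>R u" v u]]
    obtain b where b: "0 < b" "b < t"
      and gb: "g (x + a *\<^sub>R u + t *\<^sub>R v) \<bullet> u - g (x + a *\<^sub>R u) \<bullet> u
        = t * (H (x + a *\<^sub>R u + b *\<^sub>R v) v \<bullet> u)" by auto
    have "k t - k 0 = t\<^sup>2 * (H (x + a *\<^sub>R u + b *\<^sub>R v) v \<bullet> u)"
      using ka gb by (simp add: power2_eq_square add_ac)
    then show ?thesis
      using a b unfolding k_def by (intro bexI[of _ a] bexI[of _ b]) (auto simp: add_ac)
  qed
  have lim: "(\<lambda>n. H (x + a n *\<^sub>R u + b n *\<^sub>R v) w \<bullet> z) \<longlonglongrightarrow> H x w \<bullet> z"
    if "\<And>n. a n \<in> {0<..<1 / real (Suc n)}" "\<And>n. b n \<in> {0<..<1 / real (Suc n)}" for a b u v w z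
  proof -
    have to0: "(\<lambda>n. 1 / real (Suc n)) \<longlonglongrightarrow> 0"
      using LIMSEQ_inverse_real_of_nat by (simp add: inverse_eq_divide)
    have "a \<longlonglongrightarrow> 0"
      by (rule tendsto_sandwich[OF _ _ tendsto_const to0]) (use that in \<open>auto intro!: always_eventually less_imp_le\<close>)
    moreover have "b \<longlonglongrightarrow> 0"
      by (rule tendsto_sandwich[OF _ _ tendsto_const to0]) (use that in \<open>auto intro!: always_eventually less_imp_le\<close>)
    ultimately have "(\<lambda>n. x + a n *\<^sub>R u + b n *\<^sub>R v) \<longlonglongrightarrow> x + 0 *\<^sub>R u + 0 *\<^sub>R v"
      by (intro tendsto_intros)
    moreover have "isCont (\<lambda>x. H x w) x"
      using hessian_continuous by (simp add: continuous_on_eq_continuous_at)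
    ultimately have "(\<lambda>n. H (x + a n *\<^sub>R u + b n *\<^sub>R v) w) \<longlonglongrightarrow> H x w"
      by (auto intro: isCont_tendsto_compose)
    then show ?thesis by (intro tendsto_intros)
  qed
  have "\<forall>n. \<exists>a b c d. {a,b,c,d} \<subseteq> {0<..<1 / real (Suc n)} \<and>
     H (x + a *\<^sub>R u + b *\<^sub>R v) v \<bullet> u = H (x + c *\<^sub>R v + d *\<^sub>R u) u \<bullet> v"
  proof
    fix n
    let ?t = "1 / real (Suc n)"
    have t: "?t > 0" by simp
    from cross[OF t, of u v] obtain a b where ab: "a \<in> {0<..<?t}" "b \<in> {0<..<?t}" and
      1: "\<phi> (x + ?t *\<^sub>R u + ?t *\<^sub>R v) - \<phi> (x + ?t *\<^sub>R u) - \<phi> (x + ?t *\<^sub>R v) + \<phi> x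
        = ?t\<^sup>2 * (H (x + a *\<^sub>R u + b *\<^sub>R v) v \<bullet> u)" by blast
    from cross[OF t, of v u] obtain c d where cd: "c \<in> {0<..<?t}" "d \<in> {0<..<?t}" and
      2: "\<phi> (x + ?t *\<^sub>R v + ?t *\<^sub>R u) - \<phi> (x + ?t *\<^sub>R v) - \<phi> (x + ?t *\<^sub>R u) + \<phi> x
        = ?t\<^sup>2 * (H (x + c *\<^sub>R v + d *\<^sub>R u) u \<bullet> v)" by blast
    have swap: "x + ?t *\<^sub>R v + ?t *\<^sub>R u = x + ?t *\<^sub>R u + ?t *\<^sub>R v" by (simp only: add_ac)
    have "?t\<^sup>2 * (H (x + a *\<^sub>R u + b *\<^sub>R v) v \<bullet> u) = ?t\<^sup>2 * (H (x + c *\<^sub>R v + d *\<^sub>R u) u \<bullet> v)"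
      using 1 2 unfolding swap by linarith
    moreover have "?t\<^sup>2 \<noteq> 0" using t by simp
    ultimately have "H (x + a *\<^sub>R u + b *\<^sub>R v) v \<bullet> u = H (x + c *\<^sub>R v + d *\<^sub>R u) u \<bullet> v"
      by (metis mult_cancel_left)
    then show "\<exists>a b c d. {a,b,c,d} \<subseteq> {0<..<?t} \<and>
      H (x + a *\<^sub>R u + b *\<^sub>R v) v \<bullet> u = H (x + c *\<^sub>R v + d *\<^sub>R u) u \<bullet> v"
      using ab cd by blast
  qed
  then obtain a b c d where P: "\<And>n. {a n,b n,c n,d n} \<subseteq> {0<..<1 / real (Suc n)}"
    and eq: "\<And>n. H (x + a n *\<^sub>R u + b n *\<^sub>R v) v \<bullet> u = H (x + c n *\<^sub>R v + d n *\<^sub>R u) u \<bullet> v"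
    by metis
  have "(\<lambda>n. H (x + a n *\<^sub>R u + b n *\<^sub>R v) v \<bullet> u) \<longlonglongrightarrow> H x v \<bullet> u"
    by (rule lim) (use P in auto)
  moreover have "(\<lambda>n. H (x + c n *\<^sub>R v + d n *\<^sub>R u) u \<bullet> v) \<longlonglongrightarrow> H x u \<bullet> v"
    by (rule lim) (use P in auto)
  ultimately show ?thesis
    unfolding eq using LIMSEQ_unique by blast
qed

lemma quadratic_upper_bound:
  assumes "convex S" "x \<in> S" "y \<in> S"
    and Lip: "\<And>a b. a \<in> S \<Longrightarrow> b \<in> S \<Longrightarrow> norm (g a - g b) \<le> L * norm (a - b)"
  shows "\<phi> y \<le> \<phi> x + g x \<bullet> (y - x) + L / 2 * (norm (y - x))\<^sup>2"
proof -
  define s where "s = y - x"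
  define p where "p = (\<lambda>t. t * (g x \<bullet> s) + L / 2 * t\<^sup>2 * (norm s)\<^sup>2 - \<phi> (x + t *\<^sub>R s))"
  have "p 0 \<le> p 1"
  proof (rule DERIV_nonneg_imp_nondecreasing[of 0 1])
    fix t :: real assume t: "0 \<le> t" "t \<le> 1"
    have xt: "x + t *\<^sub>R s \<in> S"
      using convexD_alt[OF assms(1-3) t] by (simp add: s_def algebra_simps)
    have "DERIV p t :> g x \<bullet> s + L * t * (norm s)\<^sup>2 - g (x + t *\<^sub>R s) \<bullet> s"
      unfolding p_def by (auto intro!: derivative_eq_intros DERIV_along_line)
    moreover have "(g (x + t *\<^sub>R s) - g x) \<bullet> s \<le> L * t * (norm s)\<^sup>2"
    proof -
      have "(g (x + t *\<^sub>R s) - g x) \<bullet> s \<le> norm (g (x + t *\<^sub>R s) - g x) * norm s"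
        by (rule norm_cauchy_schwarz)
      also have "\<dots> \<le> (L * (t * norm s)) * norm s"
        using Lip[OF xt assms(2)] t by (intro mult_right_mono) auto
      finally show ?thesis by (simp add: power2_eq_square)
    qed
    ultimately show "\<exists>y. DERIV p t :> y \<and> 0 \<le> y"
      by (intro exI[of _ "g x \<bullet> s + L * t * (norm s)\<^sup>2 - g (x + t *\<^sub>R s) \<bullet> s"])
        (simp add: inner_diff_left)
  qed simp
  then show ?thesis by (simp add: p_def s_def)
qed

lemma cubic_upper_bound:
  assumes "convex S" "x \<in> S" "y \<in> S"
    and Lip: "\<And>a b d. a \<in> S \<Longrightarrow> b \<in> S \<Longrightarrow> norm (H a d - H b d) \<le> C * norm (a - b) * norm d"
  shows "\<phi> y \<le> \<phi> x + g x \<bullet> (y - x) + 1 / 2 * ((y - x) \<bullet> H x (y - x)) + C / 6 * norm (y - x) ^ 3"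
proof -
  define s where "s = y - x"
  define q where "q = (\<lambda>t. t * (H x s \<bullet> s) + C / 2 * t\<^sup>2 * norm s ^ 3 - g (x + t *\<^sub>R s) \<bullet> s)"
  have q: "q 0 \<le> q t" if "0 \<le> t" "t \<le> 1" for t
  proof (rule DERIV_nonneg_imp_nondecreasing[OF that(1)])
    fix r :: real assume "0 \<le> r" "r \<le> t"
    then have r: "0 \<le> r" "r \<le> 1" using that by auto
    have xr: "x + r *\<^sub>R s \<in> S"
      using convexD_alt[OF assms(1-3) r] by (simp add: s_def algebra_simps)
    have "DERIV q r :> H x s \<bullet> s + C * r * norm s ^ 3 - H (x + r *\<^sub>R s) s \<bullet> s"
      unfolding q_def by (auto intro!: derivative_eq_intros DERIV_gradient_along_line)
    moreover have "(H (x + r *\<^sub>R s) s - H x s) \<bullet> s \<le> C * r * norm s ^ 3"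
    proof -
      have "(H (x + r *\<^sub>R s) s - H x s) \<bullet> s \<le> norm (H (x + r *\<^sub>R s) s - H x s) * norm s"
        by (rule norm_cauchy_schwarz)
      also have "\<dots> \<le> (C * (r * norm s) * norm s) * norm s"
        using Lip[OF xr assms(2), of s] r by (intro mult_right_mono) auto
      finally show ?thesis by (simp add: power3_eq_cube)
    qed
    ultimately show "\<exists>y. DERIV q r :> y \<and> 0 \<le> y"
      by (intro exI[of _ "H x s \<bullet> s + C * r * norm s ^ 3 - H (x + r *\<^sub>R s) s \<bullet> s"])
        (simp add: inner_diff_left)
  qed
  define p where "p = (\<lambda>t. t * (g x \<bullet> s) + t\<^sup>2 / 2 * (H x s \<bullet> s) + C / 6 * t ^ 3 * norm s ^ 3
    - \<phi> (x + t *\<^sub>R s))"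
  have "p 0 \<le> p 1"
  proof (rule DERIV_nonneg_imp_nondecreasing[of 0 1])
    fix t :: real assume t: "0 \<le> t" "t \<le> 1"
    have "DERIV p t :> g x \<bullet> s + t * (H x s \<bullet> s) + C / 2 * t\<^sup>2 * norm s ^ 3 - g (x + t *\<^sub>R s) \<bullet> s"
      unfolding p_def by (auto intro!: derivative_eq_intros DERIV_along_line)
    moreover have "0 \<le> g x \<bullet> s + t * (H x s \<bullet> s) + C / 2 * t\<^sup>2 * norm s ^ 3 - g (x + t *\<^sub>R s) \<bullet> s"
      using q[OF t] by (simp add: q_def)
    ultimately show "\<exists>y. DERIV p t :> y \<and> 0 \<le> y" by blast
  qed simp
  then show ?thesis by (simp add: p_def s_def inner_commute)
qed

lemma hessian_as_limit:
  "((\<lambda>t. (g (x + t *\<^sub>R d) - g x) \<bullet> d / t) \<longlongrightarrow> H x d \<bullet> d) (at_right 0)"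
proof -
  have "((\<lambda>t. g (x + t *\<^sub>R d) \<bullet> d) has_real_derivative H x d \<bullet> d) (at 0)"
    using DERIV_gradient_along_line[of x d d 0] by simp
  then have "((\<lambda>t. (g (x + t *\<^sub>R d) \<bullet> d - g x \<bullet> d) / t) \<longlongrightarrow> H x d \<bullet> d) (at 0)"
    by (simp add: has_field_derivative_iff)
  then show ?thesis
    by (simp add: inner_diff_left filterlim_at_split)
qed

text \<open>Divide the inequality of strong convexity at \<open>x + t (y - x)\<close> by \<open>t\<close> and let \<open>t\<close> tend to \<open>0\<close>.\<close>
lemma strongly_convex_tangent:
  assumes "strongly_convex_on c C \<phi>" "x \<in> C" "y \<in> C"
  shows "\<phi> x + g x \<bullet> (y - x) + c / 2 * (norm (y - x))\<^sup>2 \<le> \<phi> y"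
proof -
  define s where "s = y - x"
  have "((\<lambda>t. (\<phi> (x + t *\<^sub>R s) - \<phi> x) / t) \<longlongrightarrow> g x \<bullet> s) (at 0)"
    using DERIV_along_line[of x s 0] by (simp add: has_field_derivative_iff)
  then have "((\<lambda>t. (\<phi> (x + t *\<^sub>R s) - \<phi> x) / t) \<longlongrightarrow> g x \<bullet> s) (at_right 0)"
    by (simp add: filterlim_at_split)
  moreover have "((\<lambda>t. \<phi> y - \<phi> x - c / 2 * (1 - t) * (norm s)\<^sup>2) \<longlongrightarrow>
      \<phi> y - \<phi> x - c / 2 * (1 - 0) * (norm s)\<^sup>2) (at_right 0)"
    by (intro tendsto_intros)
  moreover have "\<forall>\<^sub>F t in at_right 0. (\<phi> (x + t *\<^sub>R s) - \<phi> x) / t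
      \<le> \<phi> y - \<phi> x - c / 2 * (1 - t) * (norm s)\<^sup>2"
    unfolding eventually_at_right_field
  proof (intro exI[of _ 1] conjI allI impI)
    fix t :: real assume t: "0 < t" "t < 1"
    have "x + t *\<^sub>R s = (1 - t) *\<^sub>R x + t *\<^sub>R y" by (simp add: s_def algebra_simps)
    then have "\<phi> (x + t *\<^sub>R s) \<le> (1 - t) * \<phi> x + t * \<phi> y - c / 2 * t * (1 - t) * (norm (x - y))\<^sup>2"
      using assms t unfolding strongly_convex_on_def by simp
    also have "\<dots> = \<phi> x + t * (\<phi> y - \<phi> x - c / 2 * (1 - t) * (norm s)\<^sup>2)"
      by (simp add: s_def norm_minus_commute algebra_simps)
    finally show "(\<phi> (x + t *\<^sub>R s) - \<phi> x) / t \<le> \<phi> y - \<phi> x - c / 2 * (1 - t) * (norm s)\<^sup>2"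
      using t by (simp add: divide_le_eq mult.commute)
  qed simp
  ultimately have "g x \<bullet> s \<le> \<phi> y - \<phi> x - c / 2 * (1 - 0) * (norm s)\<^sup>2"
    by (intro tendsto_le[OF trivial_limit_at_right_real])
  then show ?thesis by (simp add: s_def)
qed

lemma strongly_convex_gradient_monotone:
  assumes "strongly_convex_on c C \<phi>" "x \<in> C" "y \<in> C"
  shows "c * (norm (y - x))\<^sup>2 \<le> (g y - g x) \<bullet> (y - x)"
  using strongly_convex_tangent[OF assms] strongly_convex_tangent[OF assms(1,3,2)]
  by (simp add: inner_diff_left inner_diff_right norm_minus_commute)

text \<open>The principle behind both bounds on the Hessian.  At a relative interior point of \<open>C\<close> every direction
\<open>d\<close> of the affine hull is feasible, so the Hessian form is a limit of difference quotients of the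
gradient taken inside \<open>C\<close>; the remaining points of \<open>C\<close> are limits of relative interior ones.\<close>
lemma hessian_form_in_closed:
  assumes "convex C" "x \<in> C" "closed T"
    and dir: "\<And>p r. p \<in> affine hull C \<Longrightarrow> p + r *\<^sub>R d \<in> affine hull C"
    and quot: "\<And>p t. p \<in> C \<Longrightarrow> 0 < t \<Longrightarrow> p + t *\<^sub>R d \<in> C \<Longrightarrow> (g (p + t *\<^sub>R d) - g p) \<bullet> d / t \<in> T"
  shows "H x d \<bullet> d \<in> T"
proof -
  have rel: "H p d \<bullet> d \<in> T" if p: "p \<in> rel_interior C" for p
  proof -
    from p obtain e where e: "e > 0" "ball p e \<inter> affine hull C \<subseteq> C" and pC: "p \<in> C"
      by (auto simp: mem_rel_interior_ball)
    have "\<forall>\<^sub>F t in at_right 0. (g (p + t *\<^sub>R d) - g p) \<bullet> d / t \<in> T"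
      unfolding eventually_at_right_field
    proof (intro exI[of _ "e / (norm d + 1)"] conjI allI impI)
      show "0 < e / (norm d + 1)" using e by (simp add: add_nonneg_pos)
      fix t assume t: "0 < t" "t < e / (norm d + 1)"
      have "t * norm d < e"
      proof -
        have "t * norm d \<le> t * (norm d + 1)" using t by simp
        also have "\<dots> < e" using t(2) by (simp add: pos_less_divide_eq add_nonneg_pos)
        finally show ?thesis .
      qed
      then have "p + t *\<^sub>R d \<in> ball p e" using t by (simp add: dist_norm)
      moreover have "p + t *\<^sub>R d \<in> affine hull C" using dir pC hull_inc by metis
      ultimately show "(g (p + t *\<^sub>R d) - g p) \<bullet> d / t \<in> T"
        using e quot[OF pC] t by blast
    qed
    then show ?thesis
      by (intro Lim_in_closed_set[OF assms(3) _ _ hessian_as_limit]) auto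
  qed
  have "rel_interior C \<noteq> {}" using assms(1,2) rel_interior_eq_empty by blast
  then obtain c where c: "c \<in> rel_interior C" by blast
  have "((\<lambda>t. H (x - t *\<^sub>R (x - c)) d \<bullet> d) \<longlongrightarrow> H x d \<bullet> d) (at_right 0)"
  proof -
    have "((\<lambda>t. x - t *\<^sub>R (x - c)) \<longlongrightarrow> x - 0 *\<^sub>R (x - c)) (at_right 0)"
      by (intro tendsto_intros)
    moreover have "isCont (\<lambda>x. H x d) x"
      using hessian_continuous by (simp add: continuous_on_eq_continuous_at)
    ultimately show ?thesis
      by (intro tendsto_intros) (auto intro: isCont_tendsto_compose)
  qed
  moreover have "\<forall>\<^sub>F t in at_right 0. H (x - t *\<^sub>R (x - c)) d \<bullet> d \<in> T"
    unfolding eventually_at_right_field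
    using rel_interior_convex_shrink[OF assms(1) c assms(2)] rel
    by (intro exI[of _ 1]) auto
  ultimately show ?thesis
    by (intro Lim_in_closed_set[OF assms(3)]) auto
qed

lemma hessian_ge_on_strongly_convex_ball:
  assumes "strongly_convex_on c (cball z r) \<phi>" "r > 0" "x \<in> cball z r"
  shows "c * (norm d)\<^sup>2 \<le> H x d \<bullet> d"
proof -
  have hull: "affine hull (cball z r) = UNIV"
    using assms(2) by (intro affine_hull_nonempty_interior) (auto simp: interior_cball)
  have "H x d \<bullet> d \<in> {c * (norm d)\<^sup>2..}"
  proof (rule hessian_form_in_closed[OF convex_cball assms(3)])
    fix p t assume p: "p \<in> cball z r" "0 < t" "p + t *\<^sub>R d \<in> cball z r"
    have "c * (norm (t *\<^sub>R d))\<^sup>2 \<le> (g (p + t *\<^sub>R d) - g p) \<bullet> (t *\<^sub>R d)"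
      using strongly_convex_gradient_monotone[OF assms(1) p(1,3)] by simp
    then have "t * (c * (norm d)\<^sup>2 * t) \<le> t * ((g (p + t *\<^sub>R d) - g p) \<bullet> d)"
      by (simp add: power_mult_distrib power2_eq_square mult_ac)
    then show "(g (p + t *\<^sub>R d) - g p) \<bullet> d / t \<in> {c * (norm d)\<^sup>2..}"
      using p(2) by (simp add: le_divide_eq)
  qed (simp_all add: hull)
  then show ?thesis by simp
qed

lemma hessian_le_Lipschitz:
  assumes "convex S" "x \<in> S"
    and Lip: "\<And>a b. a \<in> S \<Longrightarrow> b \<in> S \<Longrightarrow> norm (g a - g b) \<le> L * norm (a - b)"
    and dir: "\<And>p r. p \<in> affine hull S \<Longrightarrow> p + r *\<^sub>R d \<in> affine hull S"
  shows "H x d \<bullet> d \<le> L * (norm d)\<^sup>2"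
proof -
  have "H x d \<bullet> d \<in> {..L * (norm d)\<^sup>2}"
  proof (rule hessian_form_in_closed[OF assms(1,2) _ dir])
    fix p t assume p: "p \<in> S" "0 < t" "p + t *\<^sub>R d \<in> S"
    have "(g (p + t *\<^sub>R d) - g p) \<bullet> d \<le> norm (g (p + t *\<^sub>R d) - g p) * norm d"
      by (rule norm_cauchy_schwarz)
    also have "\<dots> \<le> (L * (t * norm d)) * norm d"
      using Lip[OF p(3,1)] p(2) by (intro mult_right_mono) auto
    finally show "(g (p + t *\<^sub>R d) - g p) \<bullet> d / t \<in> {..L * (norm d)\<^sup>2}"
      using p(2) by (simp add: divide_le_eq power2_eq_square mult_ac)
  qed auto
  then show ?thesis by simp
qed

section \<open>Gradient descent in a ball of strong convexity\<close>

text \<open>The mean value theorem gives \<open>u = g x1 = (H - \<beta>) s\<close> when tested against \<open>u\<close>, where \<open>s = x1 - x\<close> and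
\<open>H\<close> is the Hessian at a point of the segment.  If \<open>c \<le> H \<le> \<beta>\<close>, the form of \<open>\<beta> - H\<close> lies between \<open>0\<close>
and \<open>\<beta> - c\<close>, and since \<open>g x = -\<beta> s\<close> the gradient shrinks by \<open>1 - c / \<beta> \<le> exp (-c / \<beta>)\<close>.  The upper bound \<open>H \<le> \<beta>\<close> comes from the
Lipschitz condition on \<open>S\<close>, which says nothing about directions transversal to \<open>S\<close> (the set may have
empty interior).  This is why the next iterate \<open>x2\<close> has to lie in \<open>S\<close> too: then both \<open>s\<close> and \<open>u\<close>, a
multiple of \<open>x2 - x1\<close>, are parallel to the affine hull of \<open>S\<close>.\<close>
lemma gradient_step_contraction:
  assumes "convex S" and pts: "x \<in> S" "x1 \<in> S" "x2 \<in> S"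
    and Lip: "\<And>a b. a \<in> S \<Longrightarrow> b \<in> S \<Longrightarrow> norm (g a - g b) \<le> \<beta> * norm (a - b)"
    and "\<beta> > 0"
    and step: "\<beta> *\<^sub>R (x1 - x) = - g x" "\<beta> *\<^sub>R (x2 - x1) = - g x1"
    and sc: "strongly_convex_on c (cball z r) \<phi>" "r > 0" "x \<in> cball z r" "x1 \<in> cball z r"
  shows "norm (g x1) \<le> exp (- c / \<beta>) * norm (g x)"
proof -
  define s where "s = x1 - x"
  define u where "u = g x1"
  have gx: "g x = - (\<beta> *\<^sub>R s)" using step(1) by (simp add: s_def)
  from MVT2[OF _ DERIV_gradient_along_line[of x s u], of 0 1]
  obtain t where t: "0 < t" "t < 1"
    and mvt: "g x1 \<bullet> u - g x \<bullet> u = H (x + t *\<^sub>R s) s \<bullet> u" by (auto simp: s_def)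
  define p where "p = x + t *\<^sub>R s"
  have p_eq: "p = (1 - t) *\<^sub>R x + t *\<^sub>R x1" by (simp add: p_def s_def algebra_simps)
  have pS: "p \<in> S" unfolding p_eq using convexD_alt[OF assms(1) pts(1,2)] t by simp
  have pB: "p \<in> cball z r" unfolding p_eq using convexD_alt[OF convex_cball sc(3,4)] t by simp
  define A where "A = (\<lambda>v. \<beta> *\<^sub>R v - H p v)"
  have "linear A"
    unfolding A_def by (intro linear_compose_sub linear_hessian linear_scale_self)
  have uu: "u = - \<beta> *\<^sub>R (x2 - x1)" using step(2) by (simp add: u_def)
  have dir: "q + k *\<^sub>R (a *\<^sub>R s + b *\<^sub>R u) \<in> affine hull S" if "q \<in> affine hull S" for q k a b
  proof -
    have h: "x \<in> affine hull S" "x1 \<in> affine hull S" "x2 \<in> affine hull S"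
      using pts by (auto intro: hull_inc)
    have "q + (k * a) *\<^sub>R (x1 - x) \<in> affine hull S"
      by (rule mem_affine_3_minus[OF affine_affine_hull that h(2,1)])
    then have "q + (k * a) *\<^sub>R (x1 - x) + (- k * b * \<beta>) *\<^sub>R (x2 - x1) \<in> affine hull S"
      by (rule mem_affine_3_minus[OF affine_affine_hull _ h(3,2)])
    then show ?thesis by (simp add: s_def uu scaleR_add_right scaleR_diff_right mult_ac add.assoc)
  qed
  have "\<bar>A s \<bullet> u\<bar> \<le> (\<beta> - c) * norm s * norm u"
  proof (rule symmetric_form_bound[OF \<open>linear A\<close>])
    show "A v \<bullet> w = A w \<bullet> v" for v w
      by (simp only: A_def inner_diff_left hessian_symmetric[of p v w] inner_scaleR_left inner_commute[of v w])
    fix a b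
    let ?d = "a *\<^sub>R s + b *\<^sub>R u"
    have "H p ?d \<bullet> ?d \<le> \<beta> * (norm ?d)\<^sup>2"
      using hessian_le_Lipschitz[OF assms(1) pS Lip dir] by simp
    then show "0 \<le> A ?d \<bullet> ?d" by (simp add: A_def inner_diff_left power2_norm_eq_inner)
    have "c * (norm ?d)\<^sup>2 \<le> H p ?d \<bullet> ?d"
      by (rule hessian_ge_on_strongly_convex_ball[OF sc(1,2) pB])
    then show "A ?d \<bullet> ?d \<le> (\<beta> - c) * (norm ?d)\<^sup>2"
      by (simp add: A_def inner_diff_left power2_norm_eq_inner algebra_simps)
  qed
  moreover have "u \<bullet> u = - (A s \<bullet> u)"
    using mvt gx unfolding u_def[symmetric] p_def[symmetric]
    by (simp add: A_def inner_diff_left)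
  ultimately have "(norm u)\<^sup>2 \<le> (\<beta> - c) * norm s * norm u"
    by (simp add: power2_norm_eq_inner)
  also have "\<dots> = (1 - c / \<beta>) * norm (g x) * norm u"
    using \<open>\<beta> > 0\<close> by (simp add: gx field_simps)
  also have "\<dots> \<le> exp (- c / \<beta>) * norm (g x) * norm u"
    using exp_ge_add_one_self[of "- c / \<beta>"] by (intro mult_right_mono) auto
  finally have "norm u * norm u \<le> (exp (- c / \<beta>) * norm (g x)) * norm u"
    by (simp add: power2_eq_square)
  then show ?thesis
    unfolding u_def by (metis mult_le_cancel_right norm_ge_zero not_less zero_le_mult_iff exp_ge_zero
      order_antisym_conv)
qed

text \<open>Compare \<open>z\<close> with a point of the segment to \<open>y\<close> that is close to \<open>z\<close>.\<close>
lemma local_minimizer_minimal: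
  assumes "strongly_convex_on c C \<phi>" "c \<ge> 0" "local_minimizer \<phi> z" "z \<in> C" "y \<in> C"
  shows "\<phi> z \<le> \<phi> y"
proof -
  have "((\<lambda>t. (1 - t) *\<^sub>R z + t *\<^sub>R y) \<longlongrightarrow> (1 - 0) *\<^sub>R z + 0 *\<^sub>R y) (at_right (0::real))"
    by (intro tendsto_intros)
  then have "\<forall>\<^sub>F t in at_right (0::real). \<phi> z \<le> \<phi> ((1 - t) *\<^sub>R z + t *\<^sub>R y)"
    using assms(3) unfolding local_minimizer_def by (auto simp: filterlim_iff)
  moreover have "\<forall>\<^sub>F t in at_right (0::real). t \<in> {0<..<1}"
    by (simp add: eventually_at_right_less eventually_at_right_field exI[of _ 1])
  ultimately have "\<forall>\<^sub>F t in at_right (0::real). \<phi> z \<le> \<phi> ((1 - t) *\<^sub>R z + t *\<^sub>R y) \<and> t \<in> {0<..<1}"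
    by (rule eventually_conj)
  then obtain t where t: "\<phi> z \<le> \<phi> ((1 - t) *\<^sub>R z + t *\<^sub>R y)" "0 < t" "t < 1"
    using eventually_happens'[OF trivial_limit_at_right_real] by fastforce
  have "\<phi> ((1 - t) *\<^sub>R z + t *\<^sub>R y) \<le> (1 - t) * \<phi> z + t * \<phi> y - c / 2 * t * (1 - t) * (norm (z - y))\<^sup>2"
    using assms t unfolding strongly_convex_on_def by simp
  moreover have "0 \<le> c / 2 * t * (1 - t) * (norm (z - y))\<^sup>2" using assms(2) t by simp
  ultimately have "t * \<phi> z \<le> t * \<phi> y" using t(1) by (simp only: left_diff_distrib)
  then show ?thesis using t by simp
qed

text \<open>Shortened steps (\<open>t < 1\<close>) are covered because \<open>gradient_step_stays_in_ball\<close> argues with an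
intermediate point of the step.\<close>
lemma gradient_step_decrease:
  assumes "convex S" "x \<in> S" "x1 \<in> S"
    and Lip: "\<And>a b. a \<in> S \<Longrightarrow> b \<in> S \<Longrightarrow> norm (g a - g b) \<le> \<beta> * norm (a - b)"
    and "\<beta> > 0" and step: "\<beta> *\<^sub>R (x1 - x) = - g x" and t: "0 \<le> t" "t \<le> 1"
  shows "\<phi> (x + t *\<^sub>R (x1 - x)) \<le> \<phi> x - (t - t\<^sup>2 / 2) * (norm (g x))\<^sup>2 / \<beta>"
proof -
  let ?y = "x + t *\<^sub>R (x1 - x)"
  have s: "x1 - x = - (1 / \<beta>) *\<^sub>R g x"
  proof -
    have "(1 / \<beta>) *\<^sub>R \<beta> *\<^sub>R (x1 - x) = (1 / \<beta>) *\<^sub>R (- g x)" using step by simp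
    then show ?thesis using \<open>\<beta> > 0\<close> by simp
  qed
  have yS: "?y \<in> S" using convexD_alt[OF assms(1-3) t] by (simp add: algebra_simps)
  have "\<phi> ?y \<le> \<phi> x + g x \<bullet> (?y - x) + \<beta> / 2 * (norm (?y - x))\<^sup>2"
    by (rule quadratic_upper_bound[OF assms(1,2) yS Lip])
  also have "g x \<bullet> (?y - x) = - t * (norm (g x))\<^sup>2 / \<beta>"
    by (simp add: s power2_norm_eq_inner)
  also have "(norm (?y - x))\<^sup>2 = t\<^sup>2 * (norm (g x))\<^sup>2 / \<beta>\<^sup>2"
    by (simp add: s power_mult_distrib power_divide)
  also have "\<phi> x + - t * (norm (g x))\<^sup>2 / \<beta> + \<beta> / 2 * (t\<^sup>2 * (norm (g x))\<^sup>2 / \<beta>\<^sup>2)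
      = \<phi> x - (t - t\<^sup>2 / 2) * (norm (g x))\<^sup>2 / \<beta>"
    using \<open>\<beta> > 0\<close> by (simp add: power2_eq_square field_simps)
  finally show ?thesis .
qed

text \<open>The squared distance to \<open>z\<close> is a quadratic function of the step length.  If the full step left
the ball, some shorter step \<open>t < 1\<close> would end at exactly the distance to \<open>z\<close> at which it started.
That point lies in the ball, so \<open>\<phi>\<close> is at least \<open>\<phi> z\<close> there, and the decrease of \<open>\<phi>\<close> on the way
contradicts the tangent inequality of strong convexity.  The argument looks at \<open>\<phi>\<close> only on the segment
and at \<open>z\<close>; the center \<open>z\<close> may lie outside \<open>S\<close>, where \<open>\<beta>\<close> says nothing about \<open>\<phi>\<close>.\<close>
lemma gradient_step_stays_in_ball:
  assumes "convex S" "x \<in> S" "x1 \<in> S"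
    and Lip: "\<And>a b. a \<in> S \<Longrightarrow> b \<in> S \<Longrightarrow> norm (g a - g b) \<le> \<beta> * norm (a - b)"
    and "\<beta> > 0" and step: "\<beta> *\<^sub>R (x1 - x) = - g x"
    and sc: "strongly_convex_on c (cball z r) \<phi>" "c > 0" "local_minimizer \<phi> z" "x \<in> cball z r"
  shows "x1 \<in> cball z r"
proof (rule ccontr)
  assume out: "x1 \<notin> cball z r"
  define s where "s = x1 - x"
  define a where "a = (x - z) \<bullet> s"
  define b where "b = (norm s)\<^sup>2"
  have gx: "g x = - (\<beta> *\<^sub>R s)" using step by (simp add: s_def)
  have ng: "(norm (g x))\<^sup>2 = \<beta>\<^sup>2 * b" by (simp add: gx b_def power_mult_distrib)
  have dist: "(norm (x + t *\<^sub>R s - z))\<^sup>2 = (norm (x - z))\<^sup>2 + t * (2 * a + t * b)" for t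
  proof -
    have "x + t *\<^sub>R s - z = (x - z) + t *\<^sub>R s" by simp
    then show ?thesis
      by (simp only: power2_norm_eq_inner a_def b_def)
        (simp add: inner_add_left inner_add_right inner_commute algebra_simps)
  qed
  have r: "norm (x - z) \<le> r" using sc(4) by (simp add: dist_norm norm_minus_commute)
  then have r0: "0 \<le> r" using norm_ge_zero order_trans by blast
  have "s \<noteq> 0" using out sc(4) by (auto simp: s_def)
  then have b: "b > 0" by (simp add: b_def)
  have "x \<noteq> z"
  proof
    assume "x = z"
    have "(\<lambda>h. g z \<bullet> h) = (\<lambda>h. 0)"
      using sc(3) has_derivative_local_min[OF has_gradient] unfolding local_minimizer_def
      by (simp add: eventually_nhds_conv_at)
    then have "g z \<bullet> g z = 0" by metis
    then show False using \<open>x = z\<close> gx \<open>s \<noteq> 0\<close> \<open>\<beta> > 0\<close> by simp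
  qed
  have z: "z \<in> cball z r" using r0 by simp
  have min: "\<phi> z \<le> \<phi> y" if "y \<in> cball z r" for y
    using local_minimizer_minimal[OF sc(1) _ sc(3) z that] sc(2) by simp
  have tang: "\<phi> x - \<phi> z + c / 2 * (norm (x - z))\<^sup>2 \<le> - \<beta> * a"
    using strongly_convex_tangent[OF sc(1,4) z]
    by (simp add: gx a_def norm_minus_commute inner_diff_right inner_diff_left inner_commute algebra_simps)
  have pos: "c / 2 * (norm (x - z))\<^sup>2 > 0" using sc(2) \<open>x \<noteq> z\<close> by simp
  have "\<beta> * a < 0" using tang pos min[OF sc(4)] by simp
  then have a: "a < 0" using \<open>\<beta> > 0\<close> by (simp add: mult_less_0_iff)
  have "r\<^sup>2 < (norm (x1 - z))\<^sup>2"
    using out r0 by (intro power_strict_mono) (auto simp: dist_norm norm_minus_commute)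
  moreover have "(norm (x - z))\<^sup>2 \<le> r\<^sup>2" using r by (intro power_mono) auto
  ultimately have ab: "2 * a + b > 0" using dist[of 1] by (simp add: s_def)
  \<comment> \<open>The nonzero step length with the same distance to the center as the starting point.\<close>
  define t where "t = - 2 * a / b"
  have t: "0 < t" "t < 1" using a b ab by (auto simp: t_def field_simps)
  have tb: "t * b = - 2 * a" using b by (simp add: t_def)
  have "(norm (x + t *\<^sub>R s - z))\<^sup>2 = (norm (x - z))\<^sup>2" using dist[of t] tb by simp
  then have "norm (x + t *\<^sub>R s - z) = norm (x - z)" by simp
  then have "x + t *\<^sub>R s \<in> cball z r" using r by (simp add: dist_norm norm_minus_commute)
  then have "\<phi> z \<le> \<phi> x - (t - t\<^sup>2 / 2) * (norm (g x))\<^sup>2 / \<beta>"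
    using min gradient_step_decrease[OF assms(1-3) Lip assms(5) step, of t] t
    unfolding s_def by force
  also have "(t - t\<^sup>2 / 2) * (norm (g x))\<^sup>2 / \<beta> = \<beta> * ((1 - t / 2) * (t * b))"
    unfolding ng using \<open>\<beta> > 0\<close> by (simp add: power2_eq_square field_simps)
  finally have "\<beta> * ((1 - t / 2) * (t * b)) < - \<beta> * a"
    using tang pos by simp
  \<comment> \<open>Since \<open>t b = -2a\<close>, the inequality says \<open>-a (2 - t) < -a\<close>, although \<open>t < 1\<close>.\<close>
  then have "\<beta> * ((1 - t) * (- a)) < 0"
    unfolding tb by (simp add: algebra_simps)
  then show False using \<open>\<beta> > 0\<close> a t by (simp add: zero_less_mult_iff)
qed

end

section \<open>Minimizers of quadratic models and the smallest eigenvalue\<close>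

text \<open>The first-order condition for quadratic models: a minimizer makes the increment in each direction,
a polynomial \<open>t b + t\<^sup>2 c\<close>, nonnegative.\<close>
lemma linear_coefficient_zero:
  fixes b c :: real
  assumes "\<And>t. 0 \<le> t * b + t\<^sup>2 * c"
  shows "b = 0"
proof -
  define k where "k = \<bar>c\<bar> + 1"
  have k: "k > 0" "c < 2 * k" by (auto simp: k_def)
  \<comment> \<open>A step against the sign of \<open>b\<close>, short enough for the linear term to dominate.\<close>
  have "0 \<le> (- b / (2 * k)) * b + (- b / (2 * k))\<^sup>2 * c" by (rule assms)
  also have "\<dots> = b\<^sup>2 * (c - 2 * k) / (4 * k\<^sup>2)"
    using k by (simp add: field_simps power2_eq_square)
  finally have "0 \<le> b\<^sup>2 * (c - 2 * k)" using k by (simp add: zero_le_divide_iff)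
  then show ?thesis using k by (simp add: zero_le_mult_iff)
qed

lemma inner_transpose_matrix: "(transpose A *v w) \<bullet> v = w \<bullet> (A *v (v :: real ^ 'n))"
  by (metis dot_lmul_matrix vector_transpose_matrix transpose_transpose transpose_matrix_vector)

lemma norm_matrix_le_spec_norm: "norm (A *v v) \<le> spec_norm A * norm (v :: real ^ 'n)"
  unfolding spec_norm_def by (rule onorm[OF matrix_vector_mul_bounded_linear])

lemma spec_norm_nonneg: "0 \<le> spec_norm (A :: real ^ 'n ^ 'm)"
  unfolding spec_norm_def by (rule onorm_pos_le[OF matrix_vector_mul_bounded_linear])

lemma transpose_diff: "transpose (A - B) = transpose A - transpose (B :: real ^ 'n ^ 'm)"
  by (simp add: transpose_def vec_eq_iff)

lemma norm_transpose_le_spec_norm: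
  fixes A :: "real ^ 'n ^ 'm"
  shows "norm (transpose A *v w) \<le> spec_norm A * norm w"
proof -
  have "norm (transpose A *v w) * norm (transpose A *v w) = w \<bullet> (A *v (transpose A *v w))"
    using inner_transpose_matrix[of A w "transpose A *v w"] by (simp flip: power2_eq_square add: power2_norm_eq_inner)
  also have "\<dots> \<le> norm w * norm (A *v (transpose A *v w))" by (rule norm_cauchy_schwarz)
  also have "\<dots> \<le> norm w * (spec_norm A * norm (transpose A *v w))"
    by (intro mult_left_mono norm_matrix_le_spec_norm) auto
  finally have "norm (transpose A *v w) * norm (transpose A *v w)
      \<le> (spec_norm A * norm w) * norm (transpose A *v w)" by (simp add: mult_ac)
  then show ?thesis
    using spec_norm_nonneg[of A] by (metis mult_le_cancel_right norm_ge_zero zero_le_mult_iff order.order_iff_strict not_less)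
qed

text \<open>The minimum in the definition of \<open>lambda_min\<close> is attained, since a symmetric matrix has an eigenvalue (a
minimizer of the quadratic form on the unit sphere is an eigenvector) and only finitely many of them
(eigenvectors for distinct eigenvalues are orthogonal).\<close>
lemma lambda_min_eigenvalue:
  fixes A :: "real ^ 'n ^ 'n"
  assumes sym: "\<And>v w. (A *v v) \<bullet> w = (A *v w) \<bullet> v"
  shows "\<exists>v. norm v = 1 \<and> A *v v = lambda_min A *\<^sub>R v"
proof -
  define E where "E = {c. \<exists>v. v \<noteq> 0 \<and> A *v v = c *\<^sub>R v}"
  have ev: "\<exists>v. norm v = 1 \<and> A *v v = c *\<^sub>R v" if "c \<in> E" for c
  proof -
    from that obtain v where v: "v \<noteq> 0" "A *v v = c *\<^sub>R v" unfolding E_def by blast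
    then have "norm ((1 / norm v) *\<^sub>R v) = 1 \<and> A *v ((1 / norm v) *\<^sub>R v) = c *\<^sub>R ((1 / norm v) *\<^sub>R v)"
      by (simp add: matrix_vector_mult_scaleR)
    then show ?thesis by blast
  qed
  then obtain e where e: "\<And>c. c \<in> E \<Longrightarrow> norm (e c) = 1 \<and> A *v e c = c *\<^sub>R e c" by metis
  have "finite E"
  proof -
    have orth: "e c \<bullet> e d = 0" if "c \<in> E" "d \<in> E" "c \<noteq> d" for c d
    proof -
      have "c * (e c \<bullet> e d) = d * (e c \<bullet> e d)"
        using sym[of "e c" "e d"] e that by (simp add: inner_commute)
      then show ?thesis using that by simp
    qed
    have "inj_on e E"
    proof (rule inj_onI, rule ccontr)
      fix c d assume *: "c \<in> E" "d \<in> E" "e c = e d" "c \<noteq> d"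
      then have "e c \<bullet> e c = 0" using orth by metis
      then show False using e * by (metis inner_eq_zero_iff norm_zero zero_neq_one)
    qed
    moreover have "finite (e ` E)"
    proof (rule independent_imp_finite)
      show "independent (e ` E)"
      proof (rule pairwise_orthogonal_independent)
        show "pairwise orthogonal (e ` E)"
          unfolding pairwise_def orthogonal_def using orth by auto
        show "0 \<notin> e ` E" using e by (metis image_iff norm_zero zero_neq_one)
      qed
    qed
    ultimately show ?thesis using finite_imageD by blast
  qed
  moreover have "E \<noteq> {}"
  proof -
    let ?S = "sphere (0 :: real ^ 'n) 1"
    have "compact ?S" "?S \<noteq> {}"
      by auto
    moreover have "continuous_on ?S (\<lambda>v. (A *v v) \<bullet> v)"
      by (intro continuous_intros linear_continuous_on matrix_vector_mul_bounded_linear)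
    ultimately obtain v where v: "v \<in> ?S" and min: "\<And>w. w \<in> ?S \<Longrightarrow> (A *v v) \<bullet> v \<le> (A *v w) \<bullet> w"
      using continuous_attains_inf by meson
    define m where "m = (A *v v) \<bullet> v"
    have vv: "v \<bullet> v = 1" using v by (simp add: norm_eq_1)
    have form: "0 \<le> (A *v w) \<bullet> w - m * (w \<bullet> w)" for w
    proof (cases "w = 0")
      case False
      then have "m \<le> (A *v ((1 / norm w) *\<^sub>R w)) \<bullet> ((1 / norm w) *\<^sub>R w)"
        unfolding m_def by (intro min) simp
      also have "\<dots> = (A *v w) \<bullet> w / (w \<bullet> w)"
        by (simp add: matrix_vector_mult_scaleR dot_square_norm power2_eq_square)
      finally show ?thesis using False by (simp add: le_divide_eq)
    qed simp
    define d where "d = A *v v - m *\<^sub>R v"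
    have "0 \<le> t * (2 * (d \<bullet> d)) + t\<^sup>2 * ((A *v d) \<bullet> d - m * (d \<bullet> d))" for t
    proof -
      have "(A *v (v + t *\<^sub>R d)) \<bullet> (v + t *\<^sub>R d) - m * ((v + t *\<^sub>R d) \<bullet> (v + t *\<^sub>R d))
        = (A *v v) \<bullet> v - m * (v \<bullet> v) + t * (2 * ((A *v v) \<bullet> d) - 2 * m * (v \<bullet> d))
          + t\<^sup>2 * ((A *v d) \<bullet> d - m * (d \<bullet> d))"
        using sym[of d v]
        by (simp add: matrix_vector_right_distrib matrix_vector_mult_scaleR inner_add_left
            inner_add_right inner_commute power2_eq_square algebra_simps)
      also have "2 * ((A *v v) \<bullet> d) - 2 * m * (v \<bullet> d) = 2 * (d \<bullet> d)"
        unfolding d_def by (simp add: inner_diff_left inner_diff_right algebra_simps)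
      finally show ?thesis using form[of "v + t *\<^sub>R d"] vv by (simp add: m_def)
    qed
    then have "2 * (d \<bullet> d) = 0" by (rule linear_coefficient_zero)
    then have "A *v v = m *\<^sub>R v" by (simp add: d_def)
    moreover have "v \<noteq> 0" using vv by auto
    ultimately show ?thesis unfolding E_def by blast
  qed
  ultimately have "lambda_min A \<in> E" unfolding lambda_min_def E_def[symmetric] by (rule Min_in)
  then show ?thesis using ev by blast
qed

lemma prox_quadratic_arg_min:
  fixes A :: "real ^ 'n ^ 'm"
  assumes "is_arg_min (\<lambda>y. c + a \<bullet> (y - x) + \<rho> / 2 * (norm (A *v (y - x)))\<^sup>2 + \<beta> / 2 * (norm (y - x))\<^sup>2)
    (\<lambda>_. True) x'"
  shows "a + \<rho> *\<^sub>R (transpose A *v (A *v (x' - x))) + \<beta> *\<^sub>R (x' - x) = 0"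
proof -
  define s where "s = x' - x"
  define w where "w = a + \<rho> *\<^sub>R (transpose A *v (A *v s)) + \<beta> *\<^sub>R s"
  define q where "q = (\<lambda>s. a \<bullet> s + \<rho> / 2 * ((A *v s) \<bullet> (A *v s)) + \<beta> / 2 * (s \<bullet> s))"
  \<comment> \<open>The increment of the model in the direction of its own gradient \<open>w\<close>.\<close>
  have "0 \<le> t * (w \<bullet> w) + t\<^sup>2 * (\<rho> / 2 * ((A *v w) \<bullet> (A *v w)) + \<beta> / 2 * (w \<bullet> w))" for t
  proof -
    have "q s \<le> q (s + t *\<^sub>R w)"
    proof -
      have "x + (s + t *\<^sub>R w) - x = s + t *\<^sub>R w" by simp
      moreover have "c + a \<bullet> s + \<rho> / 2 * (norm (A *v s))\<^sup>2 + \<beta> / 2 * (norm s)\<^sup>2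
        \<le> c + a \<bullet> (y - x) + \<rho> / 2 * (norm (A *v (y - x)))\<^sup>2 + \<beta> / 2 * (norm (y - x))\<^sup>2" for y
        using assms unfolding is_arg_min_linorder s_def by blast
      ultimately show ?thesis
        by (metis (no_types) q_def power2_norm_eq_inner add_le_cancel_left add.assoc)
    qed
    also have "q (s + t *\<^sub>R w) = q s + t * (a \<bullet> w + \<rho> * ((A *v s) \<bullet> (A *v w)) + \<beta> * (s \<bullet> w))
        + t\<^sup>2 * (\<rho> / 2 * ((A *v w) \<bullet> (A *v w)) + \<beta> / 2 * (w \<bullet> w))"
      by (simp add: q_def matrix_vector_right_distrib matrix_vector_mult_scaleR inner_add_left
            inner_add_right inner_commute power2_eq_square algebra_simps add_divide_distrib)
    also have "a \<bullet> w + \<rho> * ((A *v s) \<bullet> (A *v w)) + \<beta> * (s \<bullet> w) = w \<bullet> w"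
      by (subst (4) w_def) (simp add: inner_add_left dot_lmul_matrix)
    finally show ?thesis by simp
  qed
  then have "w \<bullet> w = 0" by (rule linear_coefficient_zero)
  then show ?thesis by (simp add: w_def s_def)
qed

section \<open>Decrease of the Gauss-Newton and the cubic step\<close>

text \<open>For the Gauss-Newton step, optimality gives \<open>g x \<bullet> s = -\<rho> \<parallel>A s\<parallel>\<^sup>2 - \<beta> \<parallel>s\<parallel>\<^sup>2\<close>, which yields a decrease of
\<open>\<beta> \<parallel>s\<parallel>\<^sup>2 / 2\<close>, and \<open>\<parallel>g x\<parallel> \<le> 2 \<beta> \<parallel>s\<parallel>\<close>.\<close>
context C2_function
begin

lemma gauss_newton_step_decrease:
  fixes A :: "real ^ 'n ^ 'm"
  assumes "convex S" "x \<in> S" "x' \<in> S"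
    and Lip: "\<And>a b. a \<in> S \<Longrightarrow> b \<in> S \<Longrightarrow> norm (g a - g b) \<le> \<beta> * norm (a - b)"
    and "\<beta> > 0" "\<rho> \<ge> 0" "\<rho> * (spec_norm A)\<^sup>2 \<le> \<beta>"
    and step: "g x + \<rho> *\<^sub>R (transpose A *v (A *v (x' - x))) + \<beta> *\<^sub>R (x' - x) = 0"
  shows "\<phi> x' \<le> \<phi> x - (norm (g x))\<^sup>2 / (8 * \<beta>)"
proof -
  define s where "s = x' - x"
  have gx: "g x = - (\<rho> *\<^sub>R (transpose A *v (A *v s)) + \<beta> *\<^sub>R s)"
    using step unfolding s_def eq_neg_iff_add_eq_0 by (simp only: add.assoc)
  have "g x \<bullet> s = - \<rho> * (norm (A *v s))\<^sup>2 - \<beta> * (norm s)\<^sup>2"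
    by (simp add: gx inner_add_left inner_diff_left dot_lmul_matrix power2_norm_eq_inner)
  also have "\<dots> \<le> - \<beta> * (norm s)\<^sup>2" using \<open>\<rho> \<ge> 0\<close> by simp
  finally have dec: "\<phi> x' \<le> \<phi> x - \<beta> / 2 * (norm s)\<^sup>2"
    using quadratic_upper_bound[OF assms(1-3) Lip] by (simp add: s_def)
  have "norm (g x) \<le> \<rho> * norm (transpose A *v (A *v s)) + \<beta> * norm s"
    unfolding gx norm_minus_cancel using \<open>\<rho> \<ge> 0\<close> \<open>\<beta> > 0\<close> by (intro norm_triangle_le) simp
  also have "\<dots> \<le> \<rho> * (spec_norm A * (spec_norm A * norm s)) + \<beta> * norm s"
    using \<open>\<rho> \<ge> 0\<close> spec_norm_nonneg[of A]
    by (intro add_right_mono mult_left_mono order_trans[OF norm_transpose_le_spec_norm]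
        norm_matrix_le_spec_norm)
  also have "\<dots> = \<rho> * (spec_norm A)\<^sup>2 * norm s + \<beta> * norm s" by (simp add: power2_eq_square mult_ac)
  also have "\<dots> \<le> \<beta> * norm s + \<beta> * norm s"
    using assms(7) by (intro add_right_mono mult_right_mono) auto
  finally have "(norm (g x))\<^sup>2 \<le> (2 * \<beta> * norm s)\<^sup>2" by (intro power_mono) auto
  then have "(norm (g x))\<^sup>2 / (8 * \<beta>) \<le> \<beta> / 2 * (norm s)\<^sup>2"
    using \<open>\<beta> > 0\<close> by (simp add: divide_le_eq power_mult_distrib power2_eq_square mult_ac)
  then show ?thesis using dec by simp
qed

text \<open>The cubic model is an upper bound of \<open>\<phi>\<close> on \<open>S\<close>, so it is enough to exhibit one point with a small model
value: move along an eigenvector of negative curvature, oriented downhill.  The length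
\<open>2 \<tau> / \<upsilon>\<close> minimizes \<open>-\<tau> t\<^sup>2 / 2 + \<upsilon> t\<^sup>3 / 6\<close>.  The trial point may lie outside \<open>S\<close>, since
only the value of the model is used there.\<close>
lemma cubic_step_decrease:
  assumes "convex S" "x \<in> S" "x' \<in> S"
    and Lip: "\<And>a b d. a \<in> S \<Longrightarrow> b \<in> S \<Longrightarrow> norm (H a d - H b d) \<le> \<upsilon> * norm (a - b) * norm d"
    and "\<upsilon> > 0" "\<tau> \<ge> 0"
    and arg: "is_arg_min (\<lambda>y. \<phi> x + g x \<bullet> (y - x) + 1 / 2 * ((y - x) \<bullet> H x (y - x))
      + \<upsilon> / 6 * norm (y - x) ^ 3) (\<lambda>_. True) x'"
    and v: "norm v = 1" "H x v = c *\<^sub>R v" "c \<le> - \<tau>"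
  shows "\<phi> x' \<le> \<phi> x - 2 / 3 * \<tau> ^ 3 / \<upsilon>\<^sup>2"
proof -
  define w where "w = (if g x \<bullet> v \<le> 0 then v else - v)"
  have w: "norm w = 1" "H x w = c *\<^sub>R w" "g x \<bullet> w \<le> 0"
    using v linear_neg[OF linear_hessian, of x v] by (auto simp: w_def)
  define t where "t = 2 * \<tau> / \<upsilon>"
  have t: "0 \<le> t" using assms by (simp add: t_def)
  have "\<phi> x' \<le> \<phi> x + g x \<bullet> (x' - x) + 1 / 2 * ((x' - x) \<bullet> H x (x' - x)) + \<upsilon> / 6 * norm (x' - x) ^ 3"
    by (rule cubic_upper_bound[OF assms(1-3) Lip])
  also have "\<dots> \<le> \<phi> x + g x \<bullet> (x + t *\<^sub>R w - x)
      + 1 / 2 * ((x + t *\<^sub>R w - x) \<bullet> H x (x + t *\<^sub>R w - x)) + \<upsilon> / 6 * norm (x + t *\<^sub>R w - x) ^ 3"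
    using arg unfolding is_arg_min_linorder by blast
  also have "\<dots> = \<phi> x + t * (g x \<bullet> w) + c / 2 * t\<^sup>2 + \<upsilon> / 6 * t ^ 3"
    using t w by (simp add: linear_cmul[OF linear_hessian] power2_eq_square dot_square_norm)
  also have "\<dots> \<le> \<phi> x + 0 + (- \<tau>) / 2 * t\<^sup>2 + \<upsilon> / 6 * t ^ 3"
    using t w v by (intro add_mono mult_right_mono order_refl) (auto simp: mult_nonneg_nonpos)
  also have "\<dots> = \<phi> x - 2 / 3 * \<tau> ^ 3 / \<upsilon>\<^sup>2"
    using \<open>\<upsilon> > 0\<close> by (simp add: t_def field_simps power2_eq_square power3_eq_cube)
  finally show ?thesis .
qed

end

section \<open>Gradient and Hessian of the augmented Lagrangian\<close>
lemma grad_eqI: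
  assumes "(\<phi> has_derivative (\<lambda>h. a \<bullet> h)) (at x)"
  shows "grad \<phi> x = a"
proof -
  have "GDERIV \<phi> x :> D \<longleftrightarrow> D = a" for D
  proof
    assume "GDERIV \<phi> x :> D"
    then have "(\<lambda>h. h \<bullet> D) = (\<lambda>h. a \<bullet> h)"
      using assms has_derivative_unique unfolding gderiv_def by blast
    then show "D = a" by (metis inner_commute vector_eq_rdot)
  next
    assume "D = a"
    then show "GDERIV \<phi> x :> D"
      using assms unfolding gderiv_def by (simp add: inner_commute)
  qed
  then show ?thesis unfolding grad_def by (intro the_equality) blast+
qed

lemma has_derivative_grad:
  assumes "\<phi> differentiable (at x)"
  shows "(\<phi> has_derivative (\<lambda>h. grad \<phi> x \<bullet> h)) (at x)"
proof -
  from assms obtain f' where f': "(\<phi> has_derivative f') (at x)" unfolding differentiable_def by blast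
  then have lin: "linear f'" by (rule has_derivative_linear)
  have "f' h = adjoint f' 1 \<bullet> h" for h
    using adjoint_works[OF lin, of h 1]
    by (simp only: inner_commute[of "adjoint f' 1"] inner_real_def mult_1_right)
  then have "(\<phi> has_derivative (\<lambda>h. adjoint f' 1 \<bullet> h)) (at x)"
    using has_derivative_eq_rhs[OF f'] by blast
  then show ?thesis using grad_eqI by metis
qed

lemma jacobian_eqI:
  fixes G :: "real ^ 'n \<Rightarrow> real ^ 'm"
  assumes "(G has_derivative G') (at x)"
  shows "jacobian G (at x) *v d = G' d"
proof -
  have "(G has_derivative (*v) (jacobian G (at x))) (at x)"
    by (rule iffD1[OF jacobian_works differentiableI[OF assms]])
  from fun_cong[OF has_derivative_unique[OF this assms]] show ?thesis .
qed

lemma C2_function_grad_hess: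
  assumes "twice_cont_diff \<phi>"
  shows "C2_function \<phi> (grad \<phi>) (\<lambda>x. (*v) (hess \<phi> x))"
proof
  fix x d
  show "(\<phi> has_derivative (\<lambda>h. grad \<phi> x \<bullet> h)) (at x)"
    using assms has_derivative_grad unfolding twice_cont_diff_def twice_diff_def by blast
  show "(grad \<phi> has_derivative (*v) (hess \<phi> x)) (at x)"
    unfolding hess_def by (rule iffD1[OF jacobian_works])
      (use assms in \<open>simp add: twice_cont_diff_def twice_diff_def\<close>)
  have "continuous_on UNIV (hess \<phi>)" using assms unfolding twice_cont_diff_def by blast
  then show "continuous_on UNIV (\<lambda>x. hess \<phi> x *v d)"
    unfolding matrix_vector_mult_def by (intro continuous_intros) auto
qed

locale C2_constrained =
  fixes f :: "real ^ 'n \<Rightarrow> real" and F :: "real ^ 'n \<Rightarrow> real ^ 'm"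
  assumes objective_C2: "twice_cont_diff f" and constraint_C2: "\<And>i. twice_cont_diff (\<lambda>x. F x $ i)"
begin

sublocale obj: C2_function f "grad f" "\<lambda>x. (*v) (hess f x)"
  by (rule C2_function_grad_hess[OF objective_C2])

sublocale con: C2_function "\<lambda>x. F x $ i" "grad (\<lambda>x. F x $ i)" "\<lambda>x. (*v) (hess (\<lambda>x. F x $ i) x)" for i
  by (rule C2_function_grad_hess[OF constraint_C2])

lemma has_derivative_constraint: "(F has_derivative (*v) (jacobian F (at x))) (at x)"
proof -
  have "(F has_derivative (\<lambda>h. \<chi> i. grad (\<lambda>x. F x $ i) x \<bullet> h)) (at x)"
    by (rule has_derivative_componentwise_within[THEN iffD2])
      (auto simp: Basis_vec_def inner_axis con.has_gradient)
  from iffD1[OF jacobian_works differentiableI[OF this]] show ?thesis .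
qed

lemma jacobian_row: "(jacobian F (at x) *v h) $ i = grad (\<lambda>x. F x $ i) x \<bullet> h"
proof -
  have "((\<lambda>x. F x $ i) has_derivative (\<lambda>h. (jacobian F (at x) *v h) $ i)) (at x)"
    by (intro bounded_linear.has_derivative[OF bounded_linear_vec_nth] has_derivative_constraint)
  from fun_cong[OF has_derivative_unique[OF this con.has_gradient]] show ?thesis .
qed

text \<open>Expressing the transposed Jacobian by the gradients of the components makes the gradient of the
augmented Lagrangian a sum of products, which can be differentiated term by term.\<close>
lemma transpose_jacobian: "transpose (jacobian F (at x)) *v w = (\<Sum>i\<in>UNIV. w $ i *\<^sub>R grad (\<lambda>x. F x $ i) x)"
proof -
  have "(transpose (jacobian F (at x)) *v w) \<bullet> h = (\<Sum>i\<in>UNIV. w $ i *\<^sub>R grad (\<lambda>x. F x $ i) x) \<bullet> h" for h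
    unfolding inner_transpose_matrix by (simp add: inner_vec_def[of w] jacobian_row inner_sum_left)
  then show ?thesis using vector_eq_rdot by blast
qed

lemma aug_lag_has_gradient:
  "(aug_lag f F \<rho> l has_derivative
     (\<lambda>h. (grad f x + transpose (jacobian F (at x)) *v (l + \<rho> *\<^sub>R F x)) \<bullet> h)) (at x)"
proof -
  have "((\<lambda>x. f x + l \<bullet> F x + \<rho> / 2 * (F x \<bullet> F x)) has_derivative
      (\<lambda>h. grad f x \<bullet> h + l \<bullet> (jacobian F (at x) *v h)
        + \<rho> / 2 * (F x \<bullet> (jacobian F (at x) *v h) + (jacobian F (at x) *v h) \<bullet> F x))) (at x)"
    by (intro has_derivative_add obj.has_gradient has_derivative_inner_right has_derivative_mult_right
        has_derivative_inner has_derivative_constraint)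
  then show ?thesis
    unfolding aug_lag_def[abs_def] power2_norm_eq_inner inner_add_left inner_transpose_matrix
    by (simp add: inner_add_left inner_commute algebra_simps)
qed

lemma grad_aug_lag:
  "grad (aug_lag f F \<rho> l) x = grad f x + transpose (jacobian F (at x)) *v (l + \<rho> *\<^sub>R F x)"
  by (rule grad_eqI[OF aug_lag_has_gradient])

lemma grad_aug_lag_has_derivative:
  "(grad (aug_lag f F \<rho> l) has_derivative
     (\<lambda>d. hess f x *v d + (\<Sum>i\<in>UNIV. (l + \<rho> *\<^sub>R F x) $ i *\<^sub>R (hess (\<lambda>x. F x $ i) x *v d))
       + \<rho> *\<^sub>R (transpose (jacobian F (at x)) *v (jacobian F (at x) *v d)))) (at x)"
proof -
  have "((\<lambda>x. grad f x + (\<Sum>i\<in>UNIV. (l $ i + \<rho> * F x $ i) *\<^sub>R grad (\<lambda>x. F x $ i) x)) has_derivative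
     (\<lambda>d. hess f x *v d + (\<Sum>i\<in>UNIV. (l $ i + \<rho> * F x $ i) *\<^sub>R (hess (\<lambda>x. F x $ i) x *v d)
        + (\<rho> * (grad (\<lambda>x. F x $ i) x \<bullet> d)) *\<^sub>R grad (\<lambda>x. F x $ i) x))) (at x)"
    by (intro has_derivative_add has_derivative_sum has_derivative_scaleR obj.has_hessian con.has_hessian
        has_derivative_eq_rhs[OF has_derivative_add[OF has_derivative_const has_derivative_mult_right[OF con.has_gradient]]])
      simp
  then show ?thesis
    unfolding grad_aug_lag[abs_def] transpose_jacobian jacobian_row
    by (simp add: sum.distrib scaleR_sum_right add.assoc)
qed

lemma hess_aug_lag:
  "hess (aug_lag f F \<rho> l) x *v d
    = hess f x *v d + (\<Sum>i\<in>UNIV. (l + \<rho> *\<^sub>R F x) $ i *\<^sub>R (hess (\<lambda>x. F x $ i) x *v d))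
       + \<rho> *\<^sub>R (transpose (jacobian F (at x)) *v (jacobian F (at x) *v d))"
  unfolding hess_def[of "aug_lag f F \<rho> l"] by (rule jacobian_eqI[OF grad_aug_lag_has_derivative])

lemma constraint_continuous: "continuous_on A F"
  using has_derivative_constraint has_derivative_continuous
  by (blast intro: continuous_at_imp_continuous_on)

lemma objective_continuous: "continuous_on A f"
  using obj.has_gradient has_derivative_continuous
  by (blast intro: continuous_at_imp_continuous_on)

sublocale AL: C2_function "aug_lag f F \<rho> l" "grad (aug_lag f F \<rho> l)" "\<lambda>x. (*v) (hess (aug_lag f F \<rho> l) x)"
  for \<rho> l
proof
  fix x d
  show "(aug_lag f F \<rho> l has_derivative (\<lambda>h. grad (aug_lag f F \<rho> l) x \<bullet> h)) (at x)"
    unfolding grad_aug_lag by (rule aug_lag_has_gradient)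
  show "(grad (aug_lag f F \<rho> l) has_derivative (*v) (hess (aug_lag f F \<rho> l) x)) (at x)"
    unfolding hess_aug_lag[abs_def] by (rule grad_aug_lag_has_derivative)
  have gradc: "continuous_on UNIV (grad (\<lambda>x. F x $ i))" for i
    using con.has_hessian has_derivative_continuous by (blast intro: continuous_at_imp_continuous_on)
  show "continuous_on UNIV (\<lambda>x. hess (aug_lag f F \<rho> l) x *v d)"
    unfolding hess_aug_lag transpose_jacobian jacobian_row
    by (intro continuous_intros obj.hessian_continuous con.hessian_continuous constraint_continuous gradc)
qed

text \<open>The certificate is the multiplier \<open>l + \<rho> F(x)\<close>: the gradient of the Lagrangian for it is the gradient of
the augmented Lagrangian, and the two Hessians differ by \<open>\<rho> J\<^sup>T J\<close>, which vanishes on the kernel of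
the Jacobian \<open>J\<close>.\<close>
lemma eps_second_orderI:
  assumes "norm (grad (aug_lag f F \<rho> l) x) \<le> \<epsilon>" "norm (F x) \<le> \<epsilon>"
    and psd: "\<And>d. 0 \<le> (hess (aug_lag f F \<rho> l) x *v d) \<bullet> d" and "\<epsilon> \<ge> 0"
  shows "eps_second_order \<epsilon> f F x"
  unfolding eps_second_order_def
proof (intro exI[of _ "l + \<rho> *\<^sub>R F x"] conjI allI impI)
  show "norm (grad f x + transpose (jacobian F (at x)) *v (l + \<rho> *\<^sub>R F x)) \<le> \<epsilon>"
    using assms(1) by (simp only: grad_aug_lag)
  show "norm (F x) \<le> \<epsilon>" by fact
  fix d assume d: "jacobian F (at x) *v d = 0 \<and> norm d = 1"
  have sum: "(\<Sum>i\<in>UNIV. w $ i *\<^sub>R A i) *v d = (\<Sum>i\<in>UNIV. w $ i *\<^sub>R (A i *v d))"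
    for w :: "real ^ 'm" and A :: "'m \<Rightarrow> real ^ 'n ^ 'n"
    by (simp add: linear_sum[OF linearI[of "\<lambda>B. B *v d"]] matrix_vector_mult_add_rdistrib
        scaleR_matrix_vector_assoc)
  have "(hess f x + (\<Sum>i\<in>UNIV. (l + \<rho> *\<^sub>R F x) $ i *\<^sub>R hess (\<lambda>y. F y $ i) x)) *v d
      = hess (aug_lag f F \<rho> l) x *v d"
    using d unfolding hess_aug_lag matrix_vector_mult_add_rdistrib sum by simp
  then show "- \<epsilon> \<le> d \<bullet> ((hess f x + (\<Sum>i\<in>UNIV. (l + \<rho> *\<^sub>R F x) $ i *\<^sub>R hess (\<lambda>y. F y $ i) x)) *v d)"
    using psd[of d] \<open>\<epsilon> \<ge> 0\<close> by (simp add: inner_commute)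
qed

lemma lin_aug_lag_eq:
  "lin_aug_lag f F \<rho> l x y = aug_lag f F \<rho> l x + grad (aug_lag f F \<rho> l) x \<bullet> (y - x)
    + \<rho> / 2 * (norm (jacobian F (at x) *v (y - x)))\<^sup>2"
  unfolding lin_aug_lag_def aug_lag_def grad_aug_lag inner_add_left[of "grad f x"] inner_transpose_matrix
    power2_norm_eq_inner
  by (simp add: inner_add_left inner_add_right inner_commute algebra_simps add_divide_distrib)

end

section \<open>Lipschitz constants of the augmented Lagrangian on the compact set\<close>
locale alssf_problem = C2_constrained f F
  for f :: "real ^ 'n \<Rightarrow> real" and F :: "real ^ 'n \<Rightarrow> real ^ 'm" +
  fixes S :: "(real ^ 'n) set" and \<Lambda> :: "(real ^ 'm) set"
    and Mf MF Lf LF Hf :: real and MFi LFi HFi :: "'m \<Rightarrow> real"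
  assumes compact_S: "compact S" and convex_S: "convex S" and compact_\<Lambda>: "compact \<Lambda>"
    and smooth: "smoothness_consts f F S Mf MF Lf LF Hf MFi LFi HFi"
begin

abbreviation L :: "real \<Rightarrow> real" where "L \<equiv> L_aug F S \<Lambda> MF Lf LF"
abbreviation HL :: "real \<Rightarrow> real" where "HL \<equiv> H_aug F S \<Lambda> MF LF Hf MFi LFi HFi"

lemma consts_pos: "0 < Mf" "0 < MF" "0 < Lf" "0 < LF" "0 < Hf" "0 < MFi i" "0 < LFi i" "0 < HFi i"
  using smooth unfolding smoothness_consts_def by auto

lemma pointwise_bounds:
  assumes "x \<in> S"
  shows "spec_norm (hess f x) \<le> Lf" "spec_norm (jacobian F (at x)) \<le> MF"
    "norm (grad (\<lambda>z. F z $ i) x) \<le> MFi i" "spec_norm (hess (\<lambda>z. F z $ i) x) \<le> LFi i"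
  using smooth assms unfolding smoothness_consts_def by auto

lemma Lipschitz_bounds:
  assumes "x \<in> S" "y \<in> S"
  shows "spec_norm (hess f x - hess f y) \<le> Hf * norm (x - y)"
    "spec_norm (jacobian F (at x) - jacobian F (at y)) \<le> LF * norm (x - y)"
    "spec_norm (hess (\<lambda>z. F z $ i) x - hess (\<lambda>z. F z $ i) y) \<le> HFi i * norm (x - y)"
  using smooth assms unfolding smoothness_consts_def by auto

lemma constraint_Lipschitz:
  assumes "x \<in> S" "y \<in> S"
  shows "norm (F x - F y) \<le> MF * norm (x - y)"
  by (rule differentiable_bound[OF convex_S has_derivative_at_withinI[OF has_derivative_constraint] _ assms])
    (use pointwise_bounds(2) in \<open>auto simp: spec_norm_def\<close>)

lemma component_Lipschitz:
  assumes "x \<in> S" "y \<in> S"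
  shows "\<bar>F x $ i - F y $ i\<bar> \<le> MFi i * norm (x - y)"
proof -
  have "onorm (\<lambda>h. grad (\<lambda>z. F z $ i) x \<bullet> h) \<le> MFi i" if "x \<in> S" for x
  proof (rule onorm_le)
    fix h
    have "norm (grad (\<lambda>z. F z $ i) x \<bullet> h) \<le> norm (grad (\<lambda>z. F z $ i) x) * norm h"
      using Cauchy_Schwarz_ineq2 by simp
    also have "\<dots> \<le> MFi i * norm h" using pointwise_bounds(3)[OF that] by (intro mult_right_mono) auto
    finally show "norm (grad (\<lambda>z. F z $ i) x \<bullet> h) \<le> MFi i * norm h" .
  qed
  from differentiable_bound[OF convex_S has_derivative_at_withinI[OF con.has_gradient] this assms]
  show ?thesis by simp
qed

lemma grad_objective_Lipschitz:
  assumes "x \<in> S" "y \<in> S"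
  shows "norm (grad f x - grad f y) \<le> Lf * norm (x - y)"
  by (rule differentiable_bound[OF convex_S has_derivative_at_withinI[OF obj.has_hessian] _ assms])
    (use pointwise_bounds(1) in \<open>auto simp: spec_norm_def\<close>)

lemma bounded_data:
  "\<exists>B>0. (\<forall>x\<in>S. norm (F x) \<le> B \<and> \<bar>f x\<bar> \<le> B) \<and> (\<forall>l\<in>\<Lambda>. norm l \<le> B)"
proof -
  obtain B1 where B1: "\<And>x. x \<in> S \<Longrightarrow> norm (F x) \<le> B1"
    using compact_imp_bounded[OF compact_continuous_image[OF constraint_continuous compact_S]]
    unfolding bounded_iff by auto
  obtain B2 where B2: "\<And>l. l \<in> \<Lambda> \<Longrightarrow> norm l \<le> B2"
    using compact_imp_bounded[OF compact_\<Lambda>] unfolding bounded_iff by auto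
  obtain B3 where B3: "\<And>x. x \<in> S \<Longrightarrow> \<bar>f x\<bar> \<le> B3"
    using compact_imp_bounded[OF compact_continuous_image[OF objective_continuous compact_S]]
    unfolding bounded_iff by auto
  show ?thesis
  proof (intro exI[of _ "\<bar>B1\<bar> + \<bar>B2\<bar> + \<bar>B3\<bar> + 1"] conjI ballI)
    show "norm (F x) \<le> \<bar>B1\<bar> + \<bar>B2\<bar> + \<bar>B3\<bar> + 1" "\<bar>f x\<bar> \<le> \<bar>B1\<bar> + \<bar>B2\<bar> + \<bar>B3\<bar> + 1"
      if "x \<in> S" for x
      using B1[OF that] B3[OF that] by linarith+
    show "norm l \<le> \<bar>B1\<bar> + \<bar>B2\<bar> + \<bar>B3\<bar> + 1" if "l \<in> \<Lambda>" for l
      using B2[OF that] by linarith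
  qed linarith
qed

lemma norm_multiplier_le:
  assumes "norm l \<le> B" "norm (F x) \<le> B" "\<rho> \<ge> 0"
  shows "norm (l + \<rho> *\<^sub>R F x) \<le> B * (1 + \<rho>)"
proof -
  have "norm (l + \<rho> *\<^sub>R F x) \<le> norm l + \<rho> * norm (F x)"
    using assms(3) by (intro norm_triangle_le) simp
  also have "\<dots> \<le> B + \<rho> * B" using assms by (intro add_mono mult_left_mono) auto
  finally show ?thesis by (simp add: algebra_simps)
qed

text \<open>Serves twice: it shows that the supremum defining \<open>L_aug\<close> is over a bounded set, and that it grows at
most linearly in \<open>\<rho>\<close>.\<close>
lemma L_term_le:
  "\<exists>A>0. \<forall>\<rho>\<ge>0. \<forall>x\<in>S. \<forall>l\<in>\<Lambda>. Lf + LF * norm (l + \<rho> *\<^sub>R F x) + \<rho> * MF\<^sup>2 \<le> A * (1 + \<rho>)"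
proof -
  obtain B where B: "B > 0" "\<And>x. x \<in> S \<Longrightarrow> norm (F x) \<le> B" "\<And>l. l \<in> \<Lambda> \<Longrightarrow> norm l \<le> B"
    using bounded_data by metis
  define q where "q = MF\<^sup>2"
  have q: "0 \<le> q" by (simp add: q_def)
  show ?thesis unfolding q_def[symmetric]
  proof (intro exI[of _ "Lf + LF * B + q"] conjI allI impI ballI)
    show "0 < Lf + LF * B + q" using consts_pos(3,4) B(1) q by (simp add: add_pos_nonneg)
    fix \<rho> :: real and x l assume *: "0 \<le> \<rho>" "x \<in> S" "l \<in> \<Lambda>"
    have "LF * norm (l + \<rho> *\<^sub>R F x) \<le> LF * (B * (1 + \<rho>))"
      using * B consts_pos(4) by (intro mult_left_mono norm_multiplier_le) auto
    moreover have "0 \<le> Lf * \<rho>" using * consts_pos(3) by simp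
    ultimately show "Lf + LF * norm (l + \<rho> *\<^sub>R F x) + \<rho> * q \<le> (Lf + LF * B + q) * (1 + \<rho>)"
      using q by (simp add: algebra_simps)
  qed
qed

lemma H_term_le:
  "\<exists>A>0. \<forall>\<rho>\<ge>0. \<forall>x\<in>S. \<forall>l\<in>\<Lambda>. Hf + infnorm (l + \<rho> *\<^sub>R F x) * (\<Sum>i\<in>UNIV. HFi i)
       + \<rho> * (2 * MF * LF + (\<Sum>i\<in>UNIV. MFi i * LFi i)) \<le> A * (1 + \<rho>)"
proof -
  obtain B where B: "B > 0" "\<And>x. x \<in> S \<Longrightarrow> norm (F x) \<le> B" "\<And>l. l \<in> \<Lambda> \<Longrightarrow> norm l \<le> B"
    using bounded_data by metis
  define P where "P = (\<Sum>i\<in>UNIV. HFi i)"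
  define Q where "Q = 2 * MF * LF + (\<Sum>i\<in>UNIV. MFi i * LFi i)"
  have P: "0 \<le> P" unfolding P_def using consts_pos(8) by (intro sum_nonneg) (auto intro: less_imp_le)
  have Q: "0 \<le> Q" unfolding Q_def using consts_pos
    by (intro add_nonneg_nonneg sum_nonneg mult_nonneg_nonneg) (auto intro: less_imp_le)
  show ?thesis unfolding P_def[symmetric] Q_def[symmetric]
  proof (intro exI[of _ "Hf + B * P + Q"] conjI allI impI ballI)
    show "0 < Hf + B * P + Q" using consts_pos(5) B(1) P Q by (simp add: add_pos_nonneg)
    fix \<rho> :: real and x l assume *: "0 \<le> \<rho>" "x \<in> S" "l \<in> \<Lambda>"
    have "infnorm (l + \<rho> *\<^sub>R F x) * P \<le> (B * (1 + \<rho>)) * P"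
      using * B P by (intro mult_right_mono order_trans[OF infnorm_le_norm norm_multiplier_le]) auto
    moreover have "0 \<le> Hf * \<rho>" using * consts_pos by auto
    ultimately show "Hf + infnorm (l + \<rho> *\<^sub>R F x) * P + \<rho> * Q \<le> (Hf + B * P + Q) * (1 + \<rho>)"
      using Q by (simp add: algebra_simps)
  qed
qed

lemma L_aug_upper:
  assumes "\<rho> \<ge> 0" "x \<in> S" "l \<in> \<Lambda>"
  shows "Lf + LF * norm (l + \<rho> *\<^sub>R F x) + \<rho> * MF\<^sup>2 \<le> L \<rho>"
proof -
  have "bdd_above ((\<lambda>(x, l). Lf + LF * norm (l + \<rho> *\<^sub>R F x) + \<rho> * MF\<^sup>2) ` (S \<times> \<Lambda>))"
    using L_term_le assms(1) by (fastforce intro: bdd_aboveI2)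
  from cSUP_upper[OF _ this, of "(x, l)"] show ?thesis
    using assms by (simp add: L_aug_def)
qed

lemma H_aug_upper:
  assumes "\<rho> \<ge> 0" "x \<in> S" "l \<in> \<Lambda>"
  shows "Hf + infnorm (l + \<rho> *\<^sub>R F x) * (\<Sum>i\<in>UNIV. HFi i)
       + \<rho> * (2 * MF * LF + (\<Sum>i\<in>UNIV. MFi i * LFi i)) \<le> HL \<rho>"
proof -
  have "bdd_above ((\<lambda>(x, l). Hf + infnorm (l + \<rho> *\<^sub>R F x) * (\<Sum>i\<in>UNIV. HFi i)
       + \<rho> * (2 * MF * LF + (\<Sum>i\<in>UNIV. MFi i * LFi i))) ` (S \<times> \<Lambda>))"
    using H_term_le assms(1) by (fastforce intro: bdd_aboveI2)
  from cSUP_upper[OF _ this, of "(x, l)"] show ?thesis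
    using assms by (simp add: H_aug_def)
qed

lemma L_aug_linear_growth:
  "\<exists>A>0. \<forall>\<rho>\<ge>0. S \<noteq> {} \<longrightarrow> \<Lambda> \<noteq> {} \<longrightarrow> L \<rho> \<le> A * (1 + \<rho>)"
proof -
  obtain A where A: "A > 0" "\<forall>\<rho>\<ge>0. \<forall>x\<in>S. \<forall>l\<in>\<Lambda>. Lf + LF * norm (l + \<rho> *\<^sub>R F x) + \<rho> * MF\<^sup>2 \<le> A * (1 + \<rho>)"
    using L_term_le by (elim exE conjE)
  show ?thesis
  proof (intro exI[of _ A] conjI allI impI)
    fix \<rho> :: real
    assume "0 \<le> \<rho>" "S \<noteq> {}" "\<Lambda> \<noteq> {}"
    then show "L \<rho> \<le> A * (1 + \<rho>)"
      unfolding L_aug_def using A(2) by (intro cSUP_least) auto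
  qed (rule A(1))
qed

lemma H_aug_linear_growth:
  "\<exists>A>0. \<forall>\<rho>\<ge>0. S \<noteq> {} \<longrightarrow> \<Lambda> \<noteq> {} \<longrightarrow> HL \<rho> \<le> A * (1 + \<rho>)"
proof -
  obtain A where A: "A > 0" "\<forall>\<rho>\<ge>0. \<forall>x\<in>S. \<forall>l\<in>\<Lambda>. Hf + infnorm (l + \<rho> *\<^sub>R F x) * (\<Sum>i\<in>UNIV. HFi i)
       + \<rho> * (2 * MF * LF + (\<Sum>i\<in>UNIV. MFi i * LFi i)) \<le> A * (1 + \<rho>)"
    using H_term_le by (elim exE conjE)
  show ?thesis
  proof (intro exI[of _ A] conjI allI impI)
    fix \<rho> :: real
    assume "0 \<le> \<rho>" "S \<noteq> {}" "\<Lambda> \<noteq> {}"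
    then show "HL \<rho> \<le> A * (1 + \<rho>)"
      unfolding H_aug_def using A(2) by (intro cSUP_least) auto
  qed (rule A(1))
qed

lemma grad_aug_lag_Lipschitz:
  assumes "\<rho> \<ge> 0" "l \<in> \<Lambda>" "x \<in> S" "y \<in> S"
  shows "norm (grad (aug_lag f F \<rho> l) x - grad (aug_lag f F \<rho> l) y) \<le> L \<rho> * norm (x - y)"
proof -
  let ?J = "\<lambda>x. jacobian F (at x)" and ?m = "\<lambda>x. l + \<rho> *\<^sub>R F x"
  have eq: "grad (aug_lag f F \<rho> l) x - grad (aug_lag f F \<rho> l) y
    = (grad f x - grad f y) + transpose (?J x - ?J y) *v ?m x + transpose (?J y) *v (\<rho> *\<^sub>R (F x - F y))"
    unfolding grad_aug_lag transpose_diff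
    by (simp add: matrix_vector_right_distrib matrix_vector_mult_diff_rdistrib
        matrix_vector_mult_diff_distrib algebra_simps)
  have "norm (transpose (?J x - ?J y) *v ?m x) \<le> LF * norm (x - y) * norm (?m x)"
    by (rule order_trans[OF norm_transpose_le_spec_norm])
      (intro mult_right_mono Lipschitz_bounds assms norm_ge_zero)
  moreover have "norm (transpose (?J y) *v (\<rho> *\<^sub>R (F x - F y))) \<le> MF * (\<rho> * (MF * norm (x - y)))"
  proof -
    have "norm (transpose (?J y) *v (\<rho> *\<^sub>R (F x - F y))) \<le> spec_norm (?J y) * norm (\<rho> *\<^sub>R (F x - F y))"
      by (rule norm_transpose_le_spec_norm)
    also have "\<dots> \<le> MF * norm (\<rho> *\<^sub>R (F x - F y))"
      by (intro mult_right_mono pointwise_bounds assms norm_ge_zero)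
    also have "\<dots> \<le> MF * (\<rho> * (MF * norm (x - y)))"
      using constraint_Lipschitz[OF assms(3,4)] assms(1) consts_pos(2)
      by (auto intro!: mult_left_mono)
    finally show ?thesis .
  qed
  ultimately have "norm (grad (aug_lag f F \<rho> l) x - grad (aug_lag f F \<rho> l) y)
    \<le> Lf * norm (x - y) + LF * norm (x - y) * norm (?m x) + MF * (\<rho> * (MF * norm (x - y)))"
    unfolding eq using grad_objective_Lipschitz[OF assms(3,4)] by (intro norm_triangle_mono) auto
  also have "\<dots> = (Lf + LF * norm (?m x) + \<rho> * MF\<^sup>2) * norm (x - y)"
    by (simp add: power2_eq_square algebra_simps)
  also have "\<dots> \<le> L \<rho> * norm (x - y)"
    by (intro mult_right_mono L_aug_upper assms norm_ge_zero)
  finally show ?thesis .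
qed

text \<open>The five terms of the splitting are those in the definition of \<open>H_aug\<close>: the objective, the change of the
constraint Hessians, the change of the multipliers \<open>l + \<rho> F\<close>, and the two parts of \<open>\<rho> J\<^sup>T J\<close>.\<close>
lemma hess_aug_lag_Lipschitz:
  assumes "\<rho> \<ge> 0" "l \<in> \<Lambda>" "x \<in> S" "y \<in> S"
  shows "norm (hess (aug_lag f F \<rho> l) x *v d - hess (aug_lag f F \<rho> l) y *v d)
    \<le> HL \<rho> * norm (x - y) * norm d"
proof -
  let ?J = "\<lambda>x. jacobian F (at x)" and ?m = "\<lambda>x. l + \<rho> *\<^sub>R F x"
    and ?h = "\<lambda>i. hess (\<lambda>x. F x $ i)"
  define T1 where "T1 = (hess f x - hess f y) *v d"
  define T2 where "T2 = (\<Sum>i\<in>UNIV. ?m x $ i *\<^sub>R ((?h i x - ?h i y) *v d))"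
  define T3 where "T3 = (\<Sum>i\<in>UNIV. (\<rho> * (F x $ i - F y $ i)) *\<^sub>R (?h i y *v d))"
  define T4 where "T4 = transpose (?J x) *v ((?J x - ?J y) *v d)"
  define T5 where "T5 = transpose (?J x - ?J y) *v (?J y *v d)"
  have mat_split: "hess (aug_lag f F \<rho> l) x *v d - hess (aug_lag f F \<rho> l) y *v d
      = T1 + T2 + T3 + \<rho> *\<^sub>R (T4 + T5)"
  proof -
    have "T2 + T3 = (\<Sum>i\<in>UNIV. ?m x $ i *\<^sub>R (?h i x *v d)) - (\<Sum>i\<in>UNIV. ?m y $ i *\<^sub>R (?h i y *v d))"
      unfolding T2_def T3_def sum.distrib[symmetric] sum_subtractf[symmetric]
      by (intro sum.cong refl) (simp add: matrix_vector_mult_diff_rdistrib algebra_simps)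
    moreover have "T4 + T5 = transpose (?J x) *v (?J x *v d) - transpose (?J y) *v (?J y *v d)"
      unfolding T4_def T5_def transpose_diff
      by (simp add: matrix_vector_mult_diff_rdistrib matrix_vector_mult_diff_distrib)
    ultimately show ?thesis
      unfolding hess_aug_lag T1_def add.assoc[of _ T2 T3]
      by (simp add: matrix_vector_mult_diff_rdistrib scaleR_diff_right)
  qed
  have n1: "norm T1 \<le> Hf * norm (x - y) * norm d"
    unfolding T1_def by (rule order_trans[OF norm_matrix_le_spec_norm])
      (intro mult_right_mono Lipschitz_bounds assms norm_ge_zero)
  have n2: "norm T2 \<le> infnorm (?m x) * (\<Sum>i\<in>UNIV. HFi i) * norm (x - y) * norm d"
  proof -
    have "norm T2 \<le> (\<Sum>i\<in>UNIV. infnorm (?m x) * (HFi i * norm (x - y) * norm d))"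
      unfolding T2_def
    proof (rule sum_norm_le)
      fix i
      have "norm ((?h i x - ?h i y) *v d) \<le> HFi i * norm (x - y) * norm d"
        by (rule order_trans[OF norm_matrix_le_spec_norm])
          (intro mult_right_mono Lipschitz_bounds assms norm_ge_zero)
      then show "norm (?m x $ i *\<^sub>R ((?h i x - ?h i y) *v d)) \<le> infnorm (?m x) * (HFi i * norm (x - y) * norm d)"
        unfolding norm_scaleR by (intro mult_mono component_le_infnorm_cart infnorm_pos_le) auto
    qed
    then show ?thesis by (simp add: sum_distrib_left sum_distrib_right mult_ac)
  qed
  have n3: "norm T3 \<le> \<rho> * (\<Sum>i\<in>UNIV. MFi i * LFi i) * norm (x - y) * norm d"
  proof -
    have "norm T3 \<le> (\<Sum>i\<in>UNIV. \<rho> * (MFi i * norm (x - y)) * (LFi i * norm d))"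
      unfolding T3_def
    proof (rule sum_norm_le)
      fix i
      have "norm (?h i y *v d) \<le> LFi i * norm d"
        by (rule order_trans[OF norm_matrix_le_spec_norm])
          (intro mult_right_mono pointwise_bounds assms norm_ge_zero)
      moreover have "\<bar>\<rho> * (F x $ i - F y $ i)\<bar> \<le> \<rho> * (MFi i * norm (x - y))"
        using component_Lipschitz[OF assms(3,4), of i] assms(1)
        by (simp add: abs_mult mult_left_mono)
      ultimately show "norm ((\<rho> * (F x $ i - F y $ i)) *\<^sub>R (?h i y *v d))
          \<le> \<rho> * (MFi i * norm (x - y)) * (LFi i * norm d)"
        unfolding norm_scaleR using assms(1) consts_pos(6)[of i]
        by (intro mult_mono mult_nonneg_nonneg) auto
    qed
    then show ?thesis by (simp add: sum_distrib_left sum_distrib_right mult_ac)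
  qed
  have n4: "norm T4 \<le> MF * LF * norm (x - y) * norm d"
  proof -
    have "norm T4 \<le> spec_norm (?J x) * norm ((?J x - ?J y) *v d)"
      unfolding T4_def by (rule norm_transpose_le_spec_norm)
    also have "\<dots> \<le> MF * ((LF * norm (x - y)) * norm d)"
      using consts_pos(2)
      by (intro mult_mono pointwise_bounds assms order_trans[OF norm_matrix_le_spec_norm]
          mult_right_mono[OF Lipschitz_bounds(2)]) auto
    finally show ?thesis by (simp add: mult_ac)
  qed
  have n5: "norm T5 \<le> MF * LF * norm (x - y) * norm d"
  proof -
    have "norm T5 \<le> spec_norm (?J x - ?J y) * norm (?J y *v d)"
      unfolding T5_def by (rule norm_transpose_le_spec_norm)
    also have "\<dots> \<le> (LF * norm (x - y)) * (MF * norm d)"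
      using consts_pos(4)
      by (intro mult_mono Lipschitz_bounds assms order_trans[OF norm_matrix_le_spec_norm]
          mult_right_mono[OF pointwise_bounds(2)]) auto
    finally show ?thesis by (simp add: mult_ac)
  qed
  have "norm (\<rho> *\<^sub>R (T4 + T5)) \<le> \<rho> * (MF * LF * norm (x - y) * norm d + MF * LF * norm (x - y) * norm d)"
    using mult_left_mono[OF norm_triangle_mono[OF n4 n5] assms(1)] assms(1) by simp
  then have "norm (T1 + T2 + T3 + \<rho> *\<^sub>R (T4 + T5)) \<le> Hf * norm (x - y) * norm d
    + infnorm (?m x) * (\<Sum>i\<in>UNIV. HFi i) * norm (x - y) * norm d
    + \<rho> * (\<Sum>i\<in>UNIV. MFi i * LFi i) * norm (x - y) * norm d
    + \<rho> * (MF * LF * norm (x - y) * norm d + MF * LF * norm (x - y) * norm d)"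
    using n1 n2 n3 by (intro norm_triangle_mono)
  also have "\<dots> = (Hf + infnorm (?m x) * (\<Sum>i\<in>UNIV. HFi i)
       + \<rho> * (2 * MF * LF + (\<Sum>i\<in>UNIV. MFi i * LFi i))) * (norm (x - y) * norm d)"
    by (simp add: algebra_simps)
  also have "\<dots> \<le> HL \<rho> * (norm (x - y) * norm d)"
    by (intro mult_right_mono H_aug_upper assms mult_nonneg_nonneg norm_ge_zero)
  finally show ?thesis unfolding mat_split by (simp add: mult.assoc)
qed

end

section \<open>The iteration for a constant multiplier\<close>
lemma descent_until:
  fixes v :: "nat \<Rightarrow> real"
  assumes desc: "\<And>k. k \<ge> 1 \<Longrightarrow> \<not> P k \<Longrightarrow> v (Suc k) \<le> v k - \<delta>"
    and range: "\<And>k. k \<ge> 1 \<Longrightarrow> v 1 - v k \<le> D" and "\<delta> > 0"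
  shows "\<exists>k\<ge>1. P k \<and> (real k - 1) * \<delta> \<le> D"
proof -
  have drop: "real j * \<delta> \<le> v 1 - v (Suc j)" if "\<And>i. 1 \<le> i \<Longrightarrow> i \<le> j \<Longrightarrow> \<not> P i" for j
    using that
  proof (induction j)
    case (Suc j)
    then show ?case using desc[of "Suc j"] by (simp add: algebra_simps)
  qed simp
  have "\<exists>k\<ge>1. P k"
  proof (rule ccontr)
    assume none: "\<not> (\<exists>k\<ge>1. P k)"
    obtain j :: nat where "D / \<delta> < real j" using reals_Archimedean2 by blast
    then have "D < real j * \<delta>" using \<open>\<delta> > 0\<close> by (simp add: divide_less_eq)
    moreover have "real j * \<delta> \<le> v 1 - v (Suc j)" by (rule drop) (use none in blast)
    ultimately show False using range[of "Suc j"] by simp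
  qed
  define k where "k = (LEAST k. k \<ge> 1 \<and> P k)"
  have k: "k \<ge> 1" "P k"
    using LeastI_ex[of "\<lambda>k. k \<ge> 1 \<and> P k"] \<open>\<exists>k\<ge>1. P k\<close> unfolding k_def by blast+
  have "\<not> P i" if "1 \<le> i" "i \<le> k - 1" for i
    using not_less_Least[of i "\<lambda>k. k \<ge> 1 \<and> P k"] that k unfolding k_def[symmetric] by auto
  with drop[of "k - 1"] have "real (k - 1) * \<delta> \<le> v 1 - v k" using k by simp
  also have "\<dots> \<le> D" using range k by blast
  finally show ?thesis using k by (intro exI[of _ k]) (simp add: of_nat_diff)
qed

text \<open>A run whose multiplier does not change.  The starting point is arbitrary, so feasibility and everything
derived from it is available from \<open>x 1\<close> on only.  Here \<open>\<gamma>\<close> is the modulus of strong convexity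
including its power of \<open>\<rho>\<close>.\<close>
locale alssf_fixed_multiplier = alssf_problem f F S \<Lambda> Mf MF Lf LF Hf MFi LFi HFi
  for f :: "real ^ 'n \<Rightarrow> real" and F :: "real ^ 'n \<Rightarrow> real ^ 'm"
    and S :: "(real ^ 'n) set" and \<Lambda> :: "(real ^ 'm) set"
    and Mf MF Lf LF Hf :: real and MFi LFi HFi :: "'m \<Rightarrow> real" +
  fixes \<alpha> \<theta> \<zeta>1 \<gamma> \<xi> \<epsilon> \<rho> \<beta> \<upsilon> :: real and l :: "real ^ 'm" and x :: "nat \<Rightarrow> real ^ 'n"
  assumes pos: "\<alpha> > 0" "\<theta> > 0" "\<gamma> > 0" "\<xi> > 0" "\<epsilon> > 0" "\<rho> > 0" "\<beta> > 0" "\<upsilon> > 0"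
    and multiplier: "l \<in> \<Lambda>"
    and \<beta>_ge: "L \<rho> \<le> \<beta>" and \<upsilon>_ge: "HL \<rho> \<le> \<upsilon>"
    and step: "\<And>k. k \<ge> 1 \<Longrightarrow> alssf_primal_step f F \<alpha> \<theta> \<zeta>1 \<rho> \<beta> \<upsilon> l (x k) (x (Suc k))"
    and in_S: "\<And>k. x k \<in> S"
    and feasible: "\<And>k. k \<ge> 1 \<Longrightarrow> norm (F (x k)) \<le> \<epsilon>"
    and saddle: "strict_saddle \<alpha> (\<theta> * \<rho> powr \<zeta>1) \<gamma> \<xi> (aug_lag f F \<rho> l) {y \<in> S. norm (F y) \<le> \<epsilon>}"
    and threshold: "\<And>k. k \<ge> 1 \<Longrightarrow> \<not> on_curvature_threshold \<alpha> (\<theta> * \<rho> powr \<zeta>1) (aug_lag f F \<rho> l) (x k)"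
begin

abbreviation \<phi> :: "real ^ 'n \<Rightarrow> real" where "\<phi> \<equiv> aug_lag f F \<rho> l"
abbreviation \<tau> :: real where "\<tau> \<equiv> \<theta> * \<rho> powr \<zeta>1"

text \<open>The bound \<open>\<alpha> / 2\<close> leaves room for the gradient to double in one step without reaching the threshold
\<open>\<alpha>\<close> of the Gauss-Newton step.\<close>
definition basin :: "real ^ 'n \<Rightarrow> real ^ 'n \<Rightarrow> bool" where
  "basin z y \<longleftrightarrow> norm (grad \<phi> y) < \<alpha> / 2 \<and> y \<in> cball z \<xi> \<and>
     local_minimizer \<phi> z \<and> strongly_convex_on \<gamma> (cball z \<xi>) \<phi>"

lemma \<tau>_pos: "\<tau> > 0" using pos by simp

lemma grad_Lipschitz:
  assumes "a \<in> S" "b \<in> S"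
  shows "norm (grad \<phi> a - grad \<phi> b) \<le> \<beta> * norm (a - b)"
proof -
  have "norm (grad \<phi> a - grad \<phi> b) \<le> L \<rho> * norm (a - b)"
    using grad_aug_lag_Lipschitz pos multiplier assms by simp
  also have "\<dots> \<le> \<beta> * norm (a - b)" using \<beta>_ge by (intro mult_right_mono) auto
  finally show ?thesis .
qed

lemma hess_Lipschitz:
  assumes "a \<in> S" "b \<in> S"
  shows "norm (hess \<phi> a *v d - hess \<phi> b *v d) \<le> \<upsilon> * norm (a - b) * norm d"
proof -
  have "norm (hess \<phi> a *v d - hess \<phi> b *v d) \<le> HL \<rho> * norm (a - b) * norm d"
    using hess_aug_lag_Lipschitz pos multiplier assms by simp
  also have "\<dots> \<le> \<upsilon> * norm (a - b) * norm d" using \<upsilon>_ge by (intro mult_right_mono) auto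
  finally show ?thesis .
qed

lemma lambda_min_hess: "\<exists>v. norm v = 1 \<and> hess \<phi> y *v v = lambda_min (hess \<phi> y) *\<^sub>R v"
  by (rule lambda_min_eigenvalue[OF AL.hessian_symmetric])

lemma penalty_le_\<beta>: "\<rho> * (spec_norm (jacobian F (at (x k))))\<^sup>2 \<le> \<beta>"
proof -
  have "\<rho> * (spec_norm (jacobian F (at (x k))))\<^sup>2 \<le> \<rho> * MF\<^sup>2"
    using pos pointwise_bounds(2)[OF in_S] spec_norm_nonneg by (intro mult_left_mono power_mono) auto
  also have "\<dots> \<le> Lf + LF * norm (l + \<rho> *\<^sub>R F (x k)) + \<rho> * MF\<^sup>2" using consts_pos(3,4) by simp
  also have "\<dots> \<le> L \<rho>" using L_aug_upper in_S multiplier pos by simp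
  also have "\<dots> \<le> \<beta>" by (rule \<beta>_ge)
  finally show ?thesis .
qed

text \<open>A gradient step is a Gauss-Newton step without the penalty term, so the same first-order condition applies.\<close>
lemma gradient_step:
  assumes "k \<ge> 1" "norm (grad \<phi> (x k)) \<le> \<alpha>" "- \<tau> \<le> lambda_min (hess \<phi> (x k))"
  shows "\<beta> *\<^sub>R (x (Suc k) - x k) = - grad \<phi> (x k)"
proof -
  have "is_arg_min (\<lambda>y. grad \<phi> (x k) \<bullet> (y - x k) + \<beta> / 2 * (norm (y - x k))\<^sup>2) (\<lambda>_. True) (x (Suc k))"
    using step[OF assms(1)] assms(2,3) unfolding alssf_primal_step_def grad_aug_lag by simp
  then have "is_arg_min (\<lambda>y. 0 + grad \<phi> (x k) \<bullet> (y - x k) + 0 / 2 * (norm ((0 :: real ^ 'n ^ 'm) *v (y - x k)))\<^sup>2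
      + \<beta> / 2 * (norm (y - x k))\<^sup>2) (\<lambda>_. True) (x (Suc k))"
    by simp
  from prox_quadratic_arg_min[OF this] show ?thesis
    by (simp add: eq_neg_iff_add_eq_0 add.commute)
qed

text \<open>A gradient step outside a basin starts from a gradient of norm at least \<open>\<alpha> / 2\<close>: with a smaller gradient,
strict saddleness leaves only the curvature region, and there the strict inequality triggers the cubic
step while equality is excluded by the threshold assumption.\<close>
lemma progress:
  assumes "k \<ge> 1" and no_basin: "\<not> (\<exists>z. basin z (x k))"
  shows "\<phi> (x (Suc k)) \<le> \<phi> (x k) - min (\<alpha>\<^sup>2 / (8 * \<beta>)) (2 / 3 * \<tau> ^ 3 / \<upsilon>\<^sup>2)"
proof -
  let ?g = "norm (grad \<phi> (x k))" and ?m = "lambda_min (hess \<phi> (x k))"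
  consider (gn) "?g > \<alpha>" | (cubic) "?g \<le> \<alpha>" "?m < - \<tau>" | (gd) "?g \<le> \<alpha>" "- \<tau> \<le> ?m" by linarith
  then show ?thesis
  proof cases
    case gn
    then have "is_arg_min (\<lambda>y. \<phi> (x k) + grad \<phi> (x k) \<bullet> (y - x k)
        + \<rho> / 2 * (norm (jacobian F (at (x k)) *v (y - x k)))\<^sup>2 + \<beta> / 2 * (norm (y - x k))\<^sup>2)
        (\<lambda>_. True) (x (Suc k))"
      using step[OF assms(1)] unfolding alssf_primal_step_def lin_aug_lag_eq by simp
    from AL.gauss_newton_step_decrease[OF convex_S in_S in_S grad_Lipschitz pos(7) _ penalty_le_\<beta>
        prox_quadratic_arg_min[OF this]]
    have "\<phi> (x (Suc k)) \<le> \<phi> (x k) - ?g\<^sup>2 / (8 * \<beta>)" using pos by simp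
    moreover have "\<alpha>\<^sup>2 / (8 * \<beta>) \<le> ?g\<^sup>2 / (8 * \<beta>)"
      using gn pos by (intro divide_right_mono power_mono) auto
    ultimately show ?thesis by linarith
  next
    case cubic
    then have arg: "is_arg_min (\<lambda>y. \<phi> (x k) + grad \<phi> (x k) \<bullet> (y - x k)
        + 1 / 2 * ((y - x k) \<bullet> (hess \<phi> (x k) *v (y - x k))) + \<upsilon> / 6 * norm (y - x k) ^ 3)
        (\<lambda>_. True) (x (Suc k))"
      using step[OF assms(1)] unfolding alssf_primal_step_def quad_aug_lag_def by simp
    obtain v where v: "norm v = 1" "hess \<phi> (x k) *v v = ?m *\<^sub>R v" using lambda_min_hess by blast
    have "\<phi> (x (Suc k)) \<le> \<phi> (x k) - 2 / 3 * \<tau> ^ 3 / \<upsilon>\<^sup>2"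
      by (rule AL.cubic_step_decrease[OF convex_S in_S in_S hess_Lipschitz pos(8) _ arg v])
        (use cubic \<tau>_pos in auto)
    then show ?thesis by linarith
  next
    case gd
    have "?g \<ge> \<alpha> / 2"
    proof (rule ccontr)
      assume "\<not> ?g \<ge> \<alpha> / 2"
      then have small: "?g < \<alpha> / 2" "?g < \<alpha>" using pos(1) by auto
      have "x k \<in> {y \<in> S. norm (F y) \<le> \<epsilon>}" using in_S feasible assms(1) by blast
      then have "?g \<ge> \<alpha> \<or> ?m \<le> - \<tau> \<or> (\<exists>z. local_minimizer \<phi> z \<and> dist (x k) z \<le> \<xi> \<and>
          strongly_convex_on \<gamma> (cball z \<xi>) \<phi>)"
        using saddle unfolding strict_saddle_def by blast
      moreover have "\<not> ?m \<le> - \<tau>"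
        using threshold[OF assms(1)] gd small unfolding on_curvature_threshold_def by simp
      ultimately obtain z where "local_minimizer \<phi> z" "dist (x k) z \<le> \<xi>"
          "strongly_convex_on \<gamma> (cball z \<xi>) \<phi>" using small by auto
      then have "basin z (x k)" using small by (simp add: basin_def dist_commute)
      then show False using no_basin by blast
    qed
    then have "(\<alpha> / 2)\<^sup>2 / (2 * \<beta>) \<le> ?g\<^sup>2 / (2 * \<beta>)"
      using pos by (intro divide_right_mono power_mono) auto
    moreover have "(\<alpha> / 2)\<^sup>2 / (2 * \<beta>) = \<alpha>\<^sup>2 / (8 * \<beta>)" by (simp add: power_divide)
    moreover have "\<phi> (x (Suc k)) \<le> \<phi> (x k) - ?g\<^sup>2 / (2 * \<beta>)"
      using AL.gradient_step_decrease[OF convex_S in_S in_S grad_Lipschitz pos(7)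
          gradient_step[OF assms(1) gd], of 1] by simp
    ultimately show ?thesis by linarith
  qed
qed

lemma basin_hessian_psd:
  assumes "basin z y"
  shows "0 \<le> (hess \<phi> y *v d) \<bullet> d"
proof -
  have "0 \<le> \<gamma> * (norm d)\<^sup>2" using pos by simp
  also have "\<dots> \<le> (hess \<phi> y *v d) \<bullet> d"
    using AL.hessian_ge_on_strongly_convex_ball[OF _ pos(4)] assms unfolding basin_def by blast
  finally show ?thesis .
qed

lemma basin_gradient_step:
  assumes "k \<ge> 1" "x k \<in> cball z \<xi>" "strongly_convex_on \<gamma> (cball z \<xi>) \<phi>" "norm (grad \<phi> (x k)) \<le> \<alpha>"
  shows "\<beta> *\<^sub>R (x (Suc k) - x k) = - grad \<phi> (x k)"
proof (rule gradient_step[OF assms(1,4)])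
  obtain v where v: "norm v = 1" "hess \<phi> (x k) *v v = lambda_min (hess \<phi> (x k)) *\<^sub>R v"
    using lambda_min_hess by blast
  have "0 \<le> \<gamma> * (norm v)\<^sup>2" using pos by simp
  also have "\<dots> \<le> (hess \<phi> (x k) *v v) \<bullet> v"
    by (rule AL.hessian_ge_on_strongly_convex_ball[OF assms(3) pos(4) assms(2)])
  also have "\<dots> = lambda_min (hess \<phi> (x k))" using v by (simp add: dot_square_norm)
  finally show "- \<tau> \<le> lambda_min (hess \<phi> (x k))" using \<tau>_pos by simp
qed

text \<open>The contraction estimate for the step to \<open>x (Suc k)\<close> requires that the step after it is a gradient step, too.
The cruder bound that the gradient at most doubles settles this first.\<close>
lemma basin_step:
  assumes k: "k \<ge> 1" and basin: "basin z (x k)"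
  shows "basin z (x (Suc k))"
    and "norm (grad \<phi> (x (Suc k))) \<le> exp (- \<gamma> / \<beta>) * norm (grad \<phi> (x k))"
proof -
  have b: "norm (grad \<phi> (x k)) < \<alpha> / 2" "x k \<in> cball z \<xi>" "local_minimizer \<phi> z"
      "strongly_convex_on \<gamma> (cball z \<xi>) \<phi>"
    using basin unfolding basin_def by auto
  have st: "\<beta> *\<^sub>R (x (Suc k) - x k) = - grad \<phi> (x k)"
    using basin_gradient_step k b pos(1) by simp
  have ball: "x (Suc k) \<in> cball z \<xi>"
    by (rule AL.gradient_step_stays_in_ball[OF convex_S in_S in_S grad_Lipschitz pos(7) st b(4) pos(3) b(3,2)])
  have "norm (grad \<phi> (x (Suc k)) - grad \<phi> (x k)) \<le> \<beta> * norm (x (Suc k) - x k)"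
    by (rule grad_Lipschitz[OF in_S in_S])
  also have "\<dots> = norm (grad \<phi> (x k))"
    using arg_cong[OF st, of norm] pos(7) by simp
  finally have "norm (grad \<phi> (x (Suc k))) \<le> \<alpha>"
    using b(1) norm_triangle_ineq2[of "grad \<phi> (x (Suc k))" "grad \<phi> (x k)"] by linarith
  then have st': "\<beta> *\<^sub>R (x (Suc (Suc k)) - x (Suc k)) = - grad \<phi> (x (Suc k))"
    using basin_gradient_step[of "Suc k"] ball b by simp
  show contr: "norm (grad \<phi> (x (Suc k))) \<le> exp (- \<gamma> / \<beta>) * norm (grad \<phi> (x k))"
    by (rule AL.gradient_step_contraction[OF convex_S in_S in_S in_S grad_Lipschitz pos(7) st st'
          b(4) pos(4) b(2) ball])
  also have "\<dots> \<le> 1 * norm (grad \<phi> (x k))" using pos by (intro mult_right_mono) auto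
  finally show "basin z (x (Suc k))" using b ball unfolding basin_def by simp
qed

lemma basin_iterate:
  assumes "k \<ge> 1" "basin z (x k)"
  shows "basin z (x (k + j)) \<and> norm (grad \<phi> (x (k + j))) \<le> exp (- (real j * \<gamma> / \<beta>)) * (\<alpha> / 2)"
proof (induction j)
  case 0
  then show ?case using assms unfolding basin_def by simp
next
  case (Suc j)
  then have b: "basin z (x (k + j))" by simp
  have k: "k + j \<ge> 1" using assms by simp
  have "norm (grad \<phi> (x (Suc (k + j)))) \<le> exp (- \<gamma> / \<beta>) * (exp (- (real j * \<gamma> / \<beta>)) * (\<alpha> / 2))"
    by (rule order_trans[OF basin_step(2)[OF k b]]) (use Suc in simp)
  also have "\<dots> = exp (- (real (Suc j) * \<gamma> / \<beta>)) * (\<alpha> / 2)"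
    by (simp add: exp_add[symmetric] add_divide_distrib algebra_simps flip: mult.assoc)
  finally show ?case using basin_step(1)[OF k b] by simp
qed

text \<open>The first basin point is reached after at most \<open>1 + D / min a b \<le> 1 + D / a + D / b\<close> iterations, where
\<open>a\<close> and \<open>b\<close> are the two amounts of decrease; then the gradient contracts from \<open>\<alpha> / 2\<close> to \<open>\<epsilon>\<close>.
If \<open>\<alpha> / 2 \<le> \<epsilon>\<close> already, the logarithm is negative, whence the maximum with \<open>0\<close>.\<close>
lemma iteration_count:
  assumes range: "\<And>k. k \<ge> 1 \<Longrightarrow> \<phi> (x 1) - \<phi> (x k) \<le> D"
  shows "\<exists>k. eps_second_order \<epsilon> f F (x k) \<and>
    real k \<le> 3 + 8 * D * \<beta> / \<alpha>\<^sup>2 + 3 / 2 * D * \<upsilon>\<^sup>2 / \<tau> ^ 3 + \<beta> / \<gamma> * max 0 (ln (\<alpha> / 2 / \<epsilon>))"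
proof -
  define a where "a = \<alpha>\<^sup>2 / (8 * \<beta>)"
  define b where "b = 2 / 3 * \<tau> ^ 3 / \<upsilon>\<^sup>2"
  have ab: "a > 0" "b > 0" using pos \<tau>_pos by (auto simp: a_def b_def)
  have D: "D \<ge> 0" using range[of 1] by simp
  obtain k where k: "k \<ge> 1" "\<exists>z. basin z (x k)" "(real k - 1) * min a b \<le> D"
    using descent_until[of "\<lambda>k. \<exists>z. basin z (x k)" "\<lambda>k. \<phi> (x k)" "min a b" D, OF _ range]
      progress ab unfolding a_def b_def by auto
  have "real k - 1 \<le> D / min a b" using k(3) ab by (simp add: le_divide_eq)
  also have "\<dots> \<le> D / a + D / b" using D ab by (auto simp: min_def)
  finally have kle: "real k \<le> 1 + 8 * D * \<beta> / \<alpha>\<^sup>2 + 3 / 2 * D * \<upsilon>\<^sup>2 / \<tau> ^ 3"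
    by (simp add: a_def b_def mult_ac)
  obtain z where z: "basin z (x k)" using k by blast
  define m where "m = max 0 (ln (\<alpha> / 2 / \<epsilon>))"
  define j where "j = nat \<lceil>\<beta> / \<gamma> * m\<rceil>"
  have nn: "0 \<le> \<beta> / \<gamma> * m" using pos by (simp add: m_def)
  have j: "\<beta> / \<gamma> * m \<le> real j" "real j \<le> \<beta> / \<gamma> * m + 1"
    using nn unfolding j_def by linarith+
  have "ln (\<alpha> / 2 / \<epsilon>) \<le> m" by (simp add: m_def)
  also have "\<dots> \<le> real j * \<gamma> / \<beta>" using j(1) pos by (simp add: field_simps)
  finally have "exp (- (real j * \<gamma> / \<beta>)) \<le> exp (- ln (\<alpha> / 2 / \<epsilon>))" by simp
  also have "\<dots> = \<epsilon> / (\<alpha> / 2)" using pos by (simp add: exp_minus)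
  finally have "exp (- (real j * \<gamma> / \<beta>)) * (\<alpha> / 2) \<le> \<epsilon>" using pos by (simp add: field_simps)
  then have "norm (grad \<phi> (x (k + j))) \<le> \<epsilon>" "basin z (x (k + j))"
    using basin_iterate[OF k(1) z, of j] by auto
  then have "eps_second_order \<epsilon> f F (x (k + j))"
    using eps_second_orderI[OF _ feasible basin_hessian_psd] k pos by simp
  then show ?thesis using kle j(2) unfolding m_def by (intro exI[of _ "k + j"]) auto
qed

end

section \<open>Complexity in terms of the tolerance\<close>

text \<open>The bound of \<open>iteration_count\<close> after inserting \<open>\<rho> \<ge> 2M / \<epsilon>\<close> and the growth of order \<open>1 + 1 / \<epsilon>\<close> of \<open>\<beta>\<close> and
\<open>\<upsilon>\<close>: the terms with \<open>p\<close>, \<open>q\<close> and \<open>r\<close> count the Gauss-Newton steps and the gradient steps from large gradients, the cubic steps,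
and the final gradient steps.  The factors \<open>1 + \<epsilon>\<close> and \<open>1 + 1 / \<epsilon>\<close> make it a valid bound for every
\<open>\<epsilon> > 0\<close>, not only for small ones.\<close>
definition complexity :: "real \<Rightarrow> real \<Rightarrow> real \<Rightarrow> real \<Rightarrow> real \<Rightarrow> real \<Rightarrow> real \<Rightarrow> real" where
  "complexity p q r a \<zeta>1 \<zeta>2 \<epsilon> = 3 + p * (1 + \<epsilon>) * (1 + 1 / \<epsilon>)
     + q * (1 + \<epsilon>) * (1 + 1 / \<epsilon>)\<^sup>2 / ((1 / \<epsilon>) powr \<zeta>1) ^ 3
     + r * (1 + 1 / \<epsilon>) / (1 / \<epsilon>) powr \<zeta>2 * max 0 (ln (a / \<epsilon>))"

text \<open>In terms of \<open>w = 1 / \<epsilon>\<close> and for \<open>w > exp 1\<close>: \<open>1 + \<epsilon> \<le> 2\<close>, \<open>1 + w \<le> 2 w\<close>, and \<open>ln w \<ge> 1\<close>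
absorbs the constant \<open>ln a\<close>.\<close>
lemma complexity_bigo:
  assumes "p \<ge> 0" "q \<ge> 0" "r \<ge> 0" "a > 0"
  shows "complexity p q r a \<zeta>1 \<zeta>2 \<in> O[at_right 0](\<lambda>\<epsilon>.
    1 / \<epsilon> powr (1 - \<zeta>2) * ln (1 / \<epsilon>) + 1 / \<epsilon> + 1 / \<epsilon> powr (2 - 3 * \<zeta>1))"
proof -
  define C where "C = 3 + 4 * p + 8 * q + 2 * r * (\<bar>ln a\<bar> + 1)"
  have small: "\<forall>\<^sub>F \<epsilon> :: real in at_right 0. \<epsilon> \<in> {0<..<exp (- 1)}"
    by (rule eventually_at_right_real) simp
  show ?thesis
  proof (rule bigoI[of _ C], rule eventually_mono[OF small])
    fix \<epsilon> :: real assume "\<epsilon> \<in> {0<..<exp (- 1)}"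
    then have e: "0 < \<epsilon>" "\<epsilon> < exp (- 1)" by auto
    have "exp (- 1) < (1 :: real)" by simp
    with e have e1: "\<epsilon> < 1" by linarith
    define w where "w = 1 / \<epsilon>"
    have ew: "\<epsilon> = 1 / w" and w: "w > 1" using e e1 by (auto simp: w_def)
    have "ln \<epsilon> < - 1" using e ln_less_cancel_iff[of \<epsilon> "exp (- 1)"] by simp
    then have lnw: "ln w \<ge> 1" using e by (simp add: w_def ln_div)
    have pw: "1 / \<epsilon> powr s = w powr s" for s using e by (simp add: w_def powr_divide)
    have m: "max 0 (ln (a / \<epsilon>)) \<le> (\<bar>ln a\<bar> + 1) * ln w"
    proof -
      have "ln (a / \<epsilon>) = ln a + ln w" using e assms(4) by (simp add: w_def ln_div)
      also have "\<dots> \<le> \<bar>ln a\<bar> * ln w + ln w"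
        using mult_left_mono[OF lnw, of "\<bar>ln a\<bar>"] by simp
      finally show ?thesis using lnw by (simp add: algebra_simps)
    qed
    have t2: "p * (1 + \<epsilon>) * (1 + w) \<le> 4 * p * w"
    proof -
      have "p * (1 + \<epsilon>) * (1 + w) \<le> p * 2 * (2 * w)"
        using assms e1 e w by (intro mult_mono mult_left_mono) auto
      then show ?thesis by simp
    qed
    have t3: "q * (1 + \<epsilon>) * (1 + w)\<^sup>2 / (w powr \<zeta>1) ^ 3 \<le> 8 * q * w powr (2 - 3 * \<zeta>1)"
    proof -
      have "q * (1 + \<epsilon>) * (1 + w)\<^sup>2 / (w powr \<zeta>1) ^ 3 \<le> q * 2 * (2 * w)\<^sup>2 / (w powr \<zeta>1) ^ 3"
        using assms e1 e w by (intro divide_right_mono mult_mono mult_left_mono power_mono) auto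
      also have "\<dots> = 8 * q * (w\<^sup>2 / (w powr \<zeta>1) ^ 3)" by (simp add: power_mult_distrib)
      also have "w\<^sup>2 / (w powr \<zeta>1) ^ 3 = w powr (2 - 3 * \<zeta>1)"
      proof -
        have "(w powr \<zeta>1) ^ 3 = w powr (3 * \<zeta>1)"
          by (simp add: power3_eq_cube flip: powr_add)
        then show ?thesis using w by (simp add: powr_diff powr_numeral)
      qed
      finally show ?thesis .
    qed
    have t4: "r * (1 + w) / w powr \<zeta>2 * max 0 (ln (a / \<epsilon>))
        \<le> 2 * r * (\<bar>ln a\<bar> + 1) * (w powr (1 - \<zeta>2) * ln w)"
    proof -
      have "r * (1 + w) / w powr \<zeta>2 * max 0 (ln (a / \<epsilon>))
          \<le> r * (2 * w) / w powr \<zeta>2 * ((\<bar>ln a\<bar> + 1) * ln w)"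
        using assms w m by (intro mult_mono divide_right_mono mult_left_mono) auto
      also have "\<dots> = 2 * r * (\<bar>ln a\<bar> + 1) * (w / w powr \<zeta>2 * ln w)" by simp
      also have "w / w powr \<zeta>2 = w powr (1 - \<zeta>2)" using w by (simp add: powr_diff)
      finally show ?thesis .
    qed
    define R where "R = w powr (1 - \<zeta>2) * ln w + w + w powr (2 - 3 * \<zeta>1)"
    have parts: "0 \<le> w powr (1 - \<zeta>2) * ln w" "0 \<le> w powr (2 - 3 * \<zeta>1)" "1 \<le> w"
      using w lnw by auto
    have "complexity p q r a \<zeta>1 \<zeta>2 \<epsilon> \<le> 3 * w + 4 * p * w + 8 * q * w powr (2 - 3 * \<zeta>1)
        + 2 * r * (\<bar>ln a\<bar> + 1) * (w powr (1 - \<zeta>2) * ln w)"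
      unfolding complexity_def w_def[symmetric] using t2 t3 t4 w by linarith
    also have "\<dots> \<le> 3 * R + 4 * p * R + 8 * q * R + 2 * r * (\<bar>ln a\<bar> + 1) * R"
      using assms parts by (intro add_mono mult_left_mono) (auto simp: R_def)
    also have "\<dots> = C * R" by (simp add: C_def algebra_simps)
    finally have "complexity p q r a \<zeta>1 \<zeta>2 \<epsilon> \<le> C * R" .
    moreover have "0 \<le> complexity p q r a \<zeta>1 \<zeta>2 \<epsilon>"
      unfolding complexity_def using assms e by (intro add_nonneg_nonneg mult_nonneg_nonneg divide_nonneg_nonneg) auto
    moreover have "0 \<le> R" using parts by (simp add: R_def)
    ultimately show "norm (complexity p q r a \<zeta>1 \<zeta>2 \<epsilon>)
        \<le> C * norm (1 / \<epsilon> powr (1 - \<zeta>2) * ln (1 / \<epsilon>) + 1 / \<epsilon> + 1 / \<epsilon> powr (2 - 3 * \<zeta>1))"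
      unfolding pw w_def[symmetric] R_def[symmetric] by simp
  qed
qed

section \<open>The complexity theorem\<close>
text \<open>A dual update would change the multiplier by \<open>\<rho> \<parallel>F\<parallel> > \<rho> \<epsilon> \<ge> 2 M\<close>, more than the diameter of the
ball of radius \<open>M\<close>.\<close>
lemma multiplier_constant:
  assumes run: "alssf_run f F \<alpha> \<theta> \<zeta>1 \<epsilon> \<rho> \<beta> \<upsilon> x l" and "\<epsilon> > 0" and bound: "\<And>k. norm (l k) \<le> M"
    and \<rho>: "\<rho> \<ge> 2 * M / \<epsilon>" "\<rho> > 0"
  shows "norm (F (x (Suc k))) \<le> \<epsilon>" and "l k = l 0"
proof -
  have upd: "l (Suc k) = (if norm (F (x (Suc k))) > \<epsilon> then l k + \<rho> *\<^sub>R F (x (Suc k)) else l k)" for k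
    using run unfolding alssf_run_def by blast
  have feas: "norm (F (x (Suc k))) \<le> \<epsilon>" for k
  proof (rule ccontr)
    assume "\<not> norm (F (x (Suc k))) \<le> \<epsilon>"
    then have big: "\<epsilon> < norm (F (x (Suc k)))" by simp
    have "2 * M \<le> \<rho> * \<epsilon>" using \<rho> \<open>\<epsilon> > 0\<close> by (simp add: divide_le_eq)
    also have "\<dots> < \<rho> * norm (F (x (Suc k)))" using big \<rho>(2) by simp
    also have "\<dots> = norm (l (Suc k) - l k)" using big upd[of k] \<rho>(2) by simp
    also have "\<dots> \<le> norm (l (Suc k)) + norm (l k)" by (rule norm_triangle_ineq4)
    also have "\<dots> \<le> 2 * M" using bound[of k] bound[of "Suc k"] by simp
    finally show False by simp
  qed
  then show "norm (F (x (Suc k))) \<le> \<epsilon>" .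
  show "l k = l 0" by (induction k) (use upd feas in \<open>simp_all add: not_less[symmetric]\<close>)
qed

text \<open>The penalty term is harmless at \<open>\<epsilon>\<close>-feasible points: \<open>\<rho> \<epsilon>\<^sup>2 / 2 \<le> C \<epsilon> / 2\<close>.\<close>
lemma aug_lag_range:
  assumes "\<bar>f y\<bar> \<le> B" "\<bar>f y'\<bar> \<le> B" "norm l \<le> M" "norm (F y) \<le> \<epsilon>" "norm (F y') \<le> \<epsilon>"
    and "0 < \<epsilon>" "0 \<le> \<rho>" "\<rho> \<le> C / \<epsilon>"
  shows "aug_lag f F \<rho> l y - aug_lag f F \<rho> l y' \<le> 2 * B + (2 * M + \<bar>C\<bar>) * \<epsilon>"
proof -
  have dual: "\<bar>l \<bullet> F z\<bar> \<le> M * \<epsilon>" if "norm (F z) \<le> \<epsilon>" for z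
    by (rule order_trans[OF Cauchy_Schwarz_ineq2 mult_mono]) (use assms that norm_ge_zero[of l] norm_ge_zero[of "F z"] in linarith)+
  have "\<rho> / 2 * (norm (F y))\<^sup>2 \<le> \<rho> / 2 * \<epsilon>\<^sup>2"
    using assms by (intro mult_left_mono power_mono) auto
  also have "\<dots> \<le> (C / \<epsilon>) / 2 * \<epsilon>\<^sup>2" using assms by (intro mult_right_mono divide_right_mono) auto
  also have "\<dots> \<le> \<bar>C\<bar> * \<epsilon>" using assms(6) by (simp add: power2_eq_square field_simps abs_if)
  finally have "\<rho> / 2 * (norm (F y))\<^sup>2 \<le> \<bar>C\<bar> * \<epsilon>" .
  moreover have "0 \<le> \<rho> / 2 * (norm (F y'))\<^sup>2" using assms by simp
  ultimately show ?thesis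
    using dual[OF assms(4)] dual[OF assms(5)] assms(1,2) unfolding aug_lag_def abs_le_iff
    by (simp add: algebra_simps)
qed

theorem theorem4:
  fixes f :: "real ^ 'n \<Rightarrow> real" and F :: "real ^ 'n \<Rightarrow> real ^ 'm"
    and S :: "(real ^ 'n) set" and \<Lambda> :: "(real ^ 'm) set"
    and M C\<rho> C\<beta> \<alpha> \<theta> \<gamma> \<xi> \<zeta>1 \<zeta>2 :: real
    and Mf MF Lf LF Hf :: real and MFi LFi HFi :: "'m \<Rightarrow> real"
  assumes "twice_cont_diff f" and "\<And>i. twice_cont_diff (\<lambda>x. F x $ i)"
    and "\<exists>x. F x = 0" and "bdd_below (f ` {x. F x = 0})"
    and "compact S" and "convex S" and "compact \<Lambda>"
    and "smoothness_consts f F S Mf MF Lf LF Hf MFi LFi HFi"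
    and "\<alpha> > 0" and "\<theta> > 0" and "\<gamma> > 0" and "\<xi> > 0"
    and "\<zeta>1 \<in> {0..1}" and "\<zeta>2 \<in> {0..1}"
    and "M > 0"
  shows "\<exists>K :: real \<Rightarrow> nat.
    (\<lambda>\<epsilon>. real (K \<epsilon>)) \<in> O[at_right 0](\<lambda>\<epsilon>.
        1 / \<epsilon> powr (1 - \<zeta>2) * ln (1 / \<epsilon>) + 1 / \<epsilon> + 1 / \<epsilon> powr (2 - 3 * \<zeta>1)) \<and>
    (\<forall>\<epsilon> \<rho> \<beta> \<upsilon> x l.
        \<epsilon> > 0 \<longrightarrow> \<rho> > 0 \<longrightarrow> \<beta> > 0 \<longrightarrow> \<upsilon> > 0 \<longrightarrow>
        alssf_run f F \<alpha> \<theta> \<zeta>1 \<epsilon> \<rho> \<beta> \<upsilon> x l \<longrightarrow>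
        (\<forall>k. x k \<in> S) \<longrightarrow>
        (\<forall>k. l k \<in> \<Lambda>) \<longrightarrow>
        (\<forall>k. norm (l k) \<le> M) \<longrightarrow>
        (\<forall>k. strict_saddle \<alpha> (\<theta> * \<rho> powr \<zeta>1) (\<gamma> * \<rho> powr \<zeta>2) \<xi>
               (aug_lag f F \<rho> (l k)) {y \<in> S. norm (F y) \<le> \<epsilon>}) \<longrightarrow>
        (\<forall>k\<ge>1. \<not> on_curvature_threshold \<alpha> (\<theta> * \<rho> powr \<zeta>1) (aug_lag f F \<rho> (l k)) (x k)) \<longrightarrow>
        \<rho> \<ge> 2 * M / \<epsilon> \<longrightarrow> \<rho> \<le> C\<rho> / \<epsilon> \<longrightarrow>
        \<beta> \<ge> L_aug F S \<Lambda> MF Lf LF \<rho> \<longrightarrow> \<beta> \<le> C\<beta> * L_aug F S \<Lambda> MF Lf LF \<rho> \<longrightarrow>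
        H_aug F S \<Lambda> MF LF Hf MFi LFi HFi \<rho> \<le> \<upsilon> \<longrightarrow>
        \<upsilon> \<le> 2 * H_aug F S \<Lambda> MF LF Hf MFi LFi HFi \<rho> \<longrightarrow>
        (\<exists>k\<le>K \<epsilon>. eps_second_order \<epsilon> f F (x k)))"
proof -
  interpret alssf_problem f F S \<Lambda> Mf MF Lf LF Hf MFi LFi HFi
    by unfold_locales (use assms in auto)
  obtain B where B: "B > 0" "\<And>x. x \<in> S \<Longrightarrow> \<bar>f x\<bar> \<le> B"
    using bounded_data by metis
  obtain A1 where A1: "A1 > 0" "\<And>\<rho>. \<rho> \<ge> 0 \<Longrightarrow> S \<noteq> {} \<Longrightarrow> \<Lambda> \<noteq> {} \<Longrightarrow> L \<rho> \<le> A1 * (1 + \<rho>)"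
    using L_aug_linear_growth by metis
  obtain A2 where A2: "A2 > 0" "\<And>\<rho>. \<rho> \<ge> 0 \<Longrightarrow> S \<noteq> {} \<Longrightarrow> \<Lambda> \<noteq> {} \<Longrightarrow> HL \<rho> \<le> A2 * (1 + \<rho>)"
    using H_aug_linear_growth by metis
  \<comment> \<open>Up to factors \<open>1 + \<epsilon>\<close> and \<open>1 + 1 / \<epsilon>\<close>, \<open>D\<close> bounds the range of the augmented Lagrangian, and \<open>b\<close> and \<open>h\<close> bound \<open>\<beta>\<close> and \<open>\<upsilon>\<close>.\<close>
  define D where "D = 2 * B + 2 * M + \<bar>C\<rho>\<bar>"
  define b where "b = \<bar>C\<beta>\<bar> * A1 * (1 + \<bar>C\<rho>\<bar>)"
  define h where "h = 2 * A2 * (1 + \<bar>C\<rho>\<bar>)"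
  define p where "p = 8 * D * b / \<alpha>\<^sup>2"
  define q where "q = 3 / 2 * D * h\<^sup>2 / (\<theta> * (2 * M) powr \<zeta>1) ^ 3"
  define r where "r = b / (\<gamma> * (2 * M) powr \<zeta>2)"
  have D: "D \<ge> 0" and b: "b \<ge> 0" and h: "h \<ge> 0"
    using B(1) A1(1) A2(1) \<open>M > 0\<close> by (auto simp: D_def b_def h_def)
  have pqr: "p \<ge> 0" "q \<ge> 0" "r \<ge> 0"
    using D b h assms(9-15) by (auto simp: p_def q_def r_def)
  define T where "T = complexity p q r (\<alpha> / 2) \<zeta>1 \<zeta>2"
  define K where "K = (\<lambda>\<epsilon>. nat \<lfloor>T \<epsilon>\<rfloor>)"
  have "(\<lambda>\<epsilon>. real (K \<epsilon>)) \<in> O[at_right 0](T)"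
  proof (rule bigoI[of _ 1], rule always_eventually, rule allI)
    show "norm (real (K \<epsilon>)) \<le> 1 * norm (T \<epsilon>)" for \<epsilon> unfolding K_def by simp linarith
  qed
  also have "T \<in> O[at_right 0](\<lambda>\<epsilon>.
        1 / \<epsilon> powr (1 - \<zeta>2) * ln (1 / \<epsilon>) + 1 / \<epsilon> + 1 / \<epsilon> powr (2 - 3 * \<zeta>1))"
    unfolding T_def using complexity_bigo[OF pqr] \<open>\<alpha> > 0\<close> by simp
  finally have bigo: "(\<lambda>\<epsilon>. real (K \<epsilon>)) \<in> O[at_right 0](\<lambda>\<epsilon>.
        1 / \<epsilon> powr (1 - \<zeta>2) * ln (1 / \<epsilon>) + 1 / \<epsilon> + 1 / \<epsilon> powr (2 - 3 * \<zeta>1))" .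
  have main: "\<exists>k\<le>K \<epsilon>. eps_second_order \<epsilon> f F (x k)"
    if pos: "\<epsilon> > 0" "\<rho> > 0" "\<beta> > 0" "\<upsilon> > 0"
      and run: "alssf_run f F \<alpha> \<theta> \<zeta>1 \<epsilon> \<rho> \<beta> \<upsilon> x l"
      and x: "\<And>k. x k \<in> S" and l: "\<And>k. l k \<in> \<Lambda>" and lM: "\<And>k. norm (l k) \<le> M"
      and saddle: "\<And>k. strict_saddle \<alpha> (\<theta> * \<rho> powr \<zeta>1) (\<gamma> * \<rho> powr \<zeta>2) \<xi>
               (aug_lag f F \<rho> (l k)) {y \<in> S. norm (F y) \<le> \<epsilon>}"
      and thr: "\<And>k. k \<ge> 1 \<Longrightarrow> \<not> on_curvature_threshold \<alpha> (\<theta> * \<rho> powr \<zeta>1) (aug_lag f F \<rho> (l k)) (x k)"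
      and \<rho>: "\<rho> \<ge> 2 * M / \<epsilon>" "\<rho> \<le> C\<rho> / \<epsilon>"
      and \<beta>: "\<beta> \<ge> L \<rho>" "\<beta> \<le> C\<beta> * L \<rho>" and \<upsilon>: "HL \<rho> \<le> \<upsilon>" "\<upsilon> \<le> 2 * HL \<rho>"
    for \<epsilon> \<rho> \<beta> \<upsilon> x l
  proof -
    note const = multiplier_constant[OF run pos(1) lM \<rho>(1) pos(2)]
    have feas: "norm (F (x k)) \<le> \<epsilon>" if "k \<ge> 1" for k
      using const(1)[of "k - 1"] that by simp
    interpret run: alssf_fixed_multiplier f F S \<Lambda> Mf MF Lf LF Hf MFi LFi HFi
      \<alpha> \<theta> \<zeta>1 "\<gamma> * \<rho> powr \<zeta>2" \<xi> \<epsilon> \<rho> \<beta> \<upsilon> "l 0" x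
    proof unfold_locales
      show "alssf_primal_step f F \<alpha> \<theta> \<zeta>1 \<rho> \<beta> \<upsilon> (l 0) (x k) (x (Suc k))" for k
        using run const(2)[of k] unfolding alssf_run_def by metis
      show "\<not> on_curvature_threshold \<alpha> (\<theta> * \<rho> powr \<zeta>1) (aug_lag f F \<rho> (l 0)) (x k)" if "k \<ge> 1" for k
        using thr[OF that] const(2)[of k] by metis
    qed (use assms pos x l saddle \<beta> \<upsilon> feas in auto)
    have ne: "S \<noteq> {}" "\<Lambda> \<noteq> {}" using x l by auto
    let ?D = "2 * B + (2 * M + \<bar>C\<rho>\<bar>) * \<epsilon>"
    have "aug_lag f F \<rho> (l 0) (x 1) - aug_lag f F \<rho> (l 0) (x k) \<le> ?D" if "k \<ge> 1" for k
      by (rule aug_lag_range) (use B x lM feas that pos \<rho> in auto)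
    from run.iteration_count[OF this] obtain k where k: "eps_second_order \<epsilon> f F (x k)"
      "real k \<le> 3 + 8 * ?D * \<beta> / \<alpha>\<^sup>2 + 3 / 2 * ?D * \<upsilon>\<^sup>2 / (\<theta> * \<rho> powr \<zeta>1) ^ 3
        + \<beta> / (\<gamma> * \<rho> powr \<zeta>2) * max 0 (ln (\<alpha> / 2 / \<epsilon>))" by blast
    have Dle: "?D \<le> D * (1 + \<epsilon>)"
      using B(1) pos(1) \<open>M > 0\<close> by (simp add: D_def algebra_simps)
    have D0: "0 \<le> ?D" using B(1) pos(1) \<open>M > 0\<close> by simp
    have growth: "1 + \<rho> \<le> (1 + \<bar>C\<rho>\<bar>) * (1 + 1 / \<epsilon>)"
    proof -
      define u where "u = 1 / \<epsilon>"
      have "\<rho> \<le> \<bar>C\<rho>\<bar> * u"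
        using \<rho>(2) pos(1) mult_right_mono[OF abs_ge_self[of C\<rho>], of u] by (simp add: u_def)
      moreover have "0 \<le> u" using pos by (simp add: u_def)
      ultimately show ?thesis unfolding u_def[symmetric] by (simp add: algebra_simps)
    qed
    have "L \<rho> > 0"
    proof -
      have "0 < Lf + LF * norm (l 0 + \<rho> *\<^sub>R F (x 0)) + \<rho> * MF\<^sup>2"
        using consts_pos(3,4) pos by (intro add_pos_nonneg) auto
      then show ?thesis using L_aug_upper[OF _ x l, of \<rho> 0 0] pos by simp
    qed
    have \<beta>le: "\<beta> \<le> b * (1 + 1 / \<epsilon>)"
    proof -
      have "\<beta> \<le> \<bar>C\<beta>\<bar> * L \<rho>" using \<beta>(2) \<open>L \<rho> > 0\<close> by (meson abs_ge_self less_imp_le mult_right_mono order_trans)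
      also have "\<dots> \<le> \<bar>C\<beta>\<bar> * (A1 * ((1 + \<bar>C\<rho>\<bar>) * (1 + 1 / \<epsilon>)))"
        using A1(2)[OF _ ne, of \<rho>] pos growth A1(1)
        by (intro mult_left_mono) (auto intro: order_trans mult_left_mono)
      finally show ?thesis by (simp add: b_def mult.assoc)
    qed
    have \<upsilon>le: "\<upsilon> \<le> h * (1 + 1 / \<epsilon>)"
    proof -
      have "\<upsilon> \<le> 2 * (A2 * (1 + \<rho>))" using \<upsilon>(2) A2(2)[OF _ ne, of \<rho>] pos by simp
      also have "\<dots> \<le> 2 * (A2 * ((1 + \<bar>C\<rho>\<bar>) * (1 + 1 / \<epsilon>)))"
        using growth A2(1) by (intro mult_left_mono) auto
      finally show ?thesis by (simp add: h_def mult.assoc)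
    qed
    have \<rho>powr: "(2 * M) powr s * (1 / \<epsilon>) powr s \<le> \<rho> powr s" if "s \<ge> 0" for s
    proof -
      have "(2 * M) powr s * (1 / \<epsilon>) powr s = (2 * M / \<epsilon>) powr s"
        using \<open>M > 0\<close> pos by (simp flip: powr_mult)
      also have "\<dots> \<le> \<rho> powr s" using \<rho>(1) \<open>M > 0\<close> pos that by (intro powr_mono2) auto
      finally show ?thesis .
    qed
    have \<zeta>: "\<zeta>1 \<ge> 0" "\<zeta>2 \<ge> 0" using assms(13,14) by auto
    have t1: "8 * ?D * \<beta> / \<alpha>\<^sup>2 \<le> p * (1 + \<epsilon>) * (1 + 1 / \<epsilon>)"
    proof -
      have "8 * ?D * \<beta> / \<alpha>\<^sup>2 \<le> 8 * (D * (1 + \<epsilon>)) * (b * (1 + 1 / \<epsilon>)) / \<alpha>\<^sup>2"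
        using Dle D0 \<beta>le pos D by (intro divide_right_mono mult_mono mult_left_mono) auto
      then show ?thesis by (simp add: p_def mult_ac)
    qed
    have t2: "3 / 2 * ?D * \<upsilon>\<^sup>2 / (\<theta> * \<rho> powr \<zeta>1) ^ 3
        \<le> q * (1 + \<epsilon>) * (1 + 1 / \<epsilon>)\<^sup>2 / ((1 / \<epsilon>) powr \<zeta>1) ^ 3"
    proof -
      have "3 / 2 * ?D * \<upsilon>\<^sup>2 / (\<theta> * \<rho> powr \<zeta>1) ^ 3
          \<le> 3 / 2 * (D * (1 + \<epsilon>)) * (h * (1 + 1 / \<epsilon>))\<^sup>2 / (\<theta> * ((2 * M) powr \<zeta>1 * (1 / \<epsilon>) powr \<zeta>1)) ^ 3"
      proof (rule frac_le)
        show "3 / 2 * ?D * \<upsilon>\<^sup>2 \<le> 3 / 2 * (D * (1 + \<epsilon>)) * (h * (1 + 1 / \<epsilon>))\<^sup>2"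
          using Dle D0 \<upsilon>le pos D by (intro mult_mono mult_left_mono power_mono) auto
        show "(\<theta> * ((2 * M) powr \<zeta>1 * (1 / \<epsilon>) powr \<zeta>1)) ^ 3 \<le> (\<theta> * \<rho> powr \<zeta>1) ^ 3"
          using \<rho>powr[OF \<zeta>(1)] \<open>\<theta> > 0\<close> by (intro power_mono mult_left_mono) auto
        show "0 < (\<theta> * ((2 * M) powr \<zeta>1 * (1 / \<epsilon>) powr \<zeta>1)) ^ 3"
          using \<open>\<theta> > 0\<close> \<open>M > 0\<close> pos by simp
        show "0 \<le> 3 / 2 * (D * (1 + \<epsilon>)) * (h * (1 + 1 / \<epsilon>))\<^sup>2"
          using D pos by simp
      qed
      then show ?thesis
        by (simp only: q_def power_mult_distrib times_divide_eq_left times_divide_eq_right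
            divide_divide_eq_left mult_ac)
    qed
    have t3: "\<beta> / (\<gamma> * \<rho> powr \<zeta>2) * max 0 (ln (\<alpha> / 2 / \<epsilon>))
        \<le> r * (1 + 1 / \<epsilon>) / (1 / \<epsilon>) powr \<zeta>2 * max 0 (ln (\<alpha> / 2 / \<epsilon>))"
    proof (rule mult_right_mono)
      have "\<beta> / (\<gamma> * \<rho> powr \<zeta>2) \<le> b * (1 + 1 / \<epsilon>) / (\<gamma> * ((2 * M) powr \<zeta>2 * (1 / \<epsilon>) powr \<zeta>2))"
        using \<beta>le b pos \<rho>powr[OF \<zeta>(2)] \<open>\<gamma> > 0\<close> \<open>M > 0\<close> by (intro frac_le mult_left_mono) auto
      then show "\<beta> / (\<gamma> * \<rho> powr \<zeta>2) \<le> r * (1 + 1 / \<epsilon>) / (1 / \<epsilon>) powr \<zeta>2"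
        by (simp add: r_def mult_ac)
    qed simp
    have "real k \<le> T \<epsilon>"
      unfolding T_def complexity_def using k(2) t1 t2 t3 by linarith
    then have "k \<le> K \<epsilon>" unfolding K_def by linarith
    then show ?thesis using k(1) by blast
  qed
  show ?thesis
    using bigo main by (intro exI[of _ K] conjI allI impI) blast+
qed

end
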